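(* Let $\mu,\nu$ be compactly supported probability measures on $\mathbb{R}$ such that $\mu$ is non-degenerate. Then for all real $z<z^*_{\mu\boxplus\nu}$, $$U_{\mu\boxplus\nu}(z)=\inf_{g\in\hat{\mathcal{E}}_{\mu,\nu,z}\cap(0,g^*_{\mu\boxplus\nu})}E_{\mu,\nu,z}(g)=\inf_{g\in\mathcal{E}_{\mu,\nu,z}\cap(0,g^*_{\mu\boxplus\nu})}E_{\mu,\nu,z}(g).$$ Furthermore, the unique minimizer of both infima is $g=G_{\mu\boxplus\nu}(z)$.
   Context: For a compactly supported probability measure $\rho$ on $\mathbb{R}$: $\operatorname{supp}_-\rho$ and $\operatorname{supp}_+\rho$ are the infimum and supremum of its support; $\rho$ is non-degenerate if it is not a Dirac mass. $U_\rho(z)=\int\log|z-\lambda|\,\rho(d\lambda)$ is the logarithmic potential. The Stieltjes transform is $G_\rho(z)=\int\frac{\rho(d\lambda)}{\lambda-z}$ (note the sign). On the real line, $G_\rho$ is strictly increasing and positive on $(-\infty,\operatorname{supp}_-\rho)$, strictly increasing and negative on $(\operatorname{supp}_+\rho,\infty)$; set $G_\rho(\operatorname{supp}_-\rho)=\lim_{z\uparrow\operatorname{supp}_-\rho}G_\rho(z)\in(0,\infty]$ and $G_\rho(\operatorname{supp}_+\rho)=\lim_{z\downarrow\operatorname{supp}_+\rho}G_\rho(z)\in[-\infty,0)$. $G_\rho^{\langle-1\rangle}$ is the inverse of $G_\rho$ restricted to $\mathbb{R}\setminus[\operatorname{supp}_-\rho,\operatorname{supp}_+\rho]$. Let $\hat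 D_\rho=(-G_\rho(\operatorname{supp}_-\rho),-G_\rho(\operatorname{supp}_+\rho))$, and $\hat R_\rho(t)=G_\rho^{\langle-1\rangle}(-t)-t^{-1}$ for $t\in\hat D_\rho\setminus\{0\}$. The real $R$-transform $R_\rho:D_\rho\to\mathbb{R}$ is the unique real analytic extension of $\hat R_\rho$ to a maximal open interval $D_\rho\supset\hat D_\rho$ (so $0\in D_\rho$). The free additive convolution $\mu\boxplus\nu$ is the unique compactly supported probability measure with $D_\mu\cap D_\nu\subset D_{\mu\boxplus\nu}$ and $R_{\mu\boxplus\nu}=R_\mu+R_\nu$ on $D_\mu\cap D_\nu$. $z^*_{\mu\boxplus\nu}=\operatorname{supp}_-(\mu\boxplus\nu)$ and $g^*_{\mu\boxplus\nu}=G_{\mu\boxplus\nu}(z^*_{\mu\boxplus\nu})=\lim_{z\uparrow z^*_{\mu\boxplus\nu}}G_{\mu\boxplus\nu}(z)\in(0,\infty]$. For $z\in\mathbb{R}$: $\mathcal{E}_{\mu,\nu,z}=\{g\in-D_\mu: z-R_\mu(-g)<\operatorname{supp}_-\nu\}$, $\hat{\mathcal{E}}_{\mu,\nu,z}=\{g\in-\hat D_\mu: z-R_\mu(-g)<\operatorname{supp}_-\nu\}$, and for $g\in\mathcal{E}_{\mu,\nu,z}$ $$E_{\mu,\nu,z}(g)=\int_0^g sR_\mu'(-s)\,ds+\int\log(\lambda-z+R_\mu(-g))\,\nu(d\lambda).$$ *)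

theory Defs
  imports "HOL-Probability.Probability"
begin

definition msupport :: "real measure \<Rightarrow> real set" where
  "msupport \<rho> = {x. \<forall>U. open U \<and> x \<in> U \<longrightarrow> measure \<rho> U > 0}"

definition compact_prob :: "real measure \<Rightarrow> bool" where
  "compact_prob \<rho> \<longleftrightarrow> real_distribution \<rho> \<and> compact (msupport \<rho>)"

definition supp_minus :: "real measure \<Rightarrow> real" where
  "supp_minus \<rho> = Inf (msupport \<rho>)"

definition supp_plus :: "real measure \<Rightarrow> real" where
  "supp_plus \<rho> = Sup (msupport \<rho>)"

definition non_degenerate :: "real measure \<Rightarrow> bool" where
  "non_degenerate \<rho> \<longleftrightarrow> (\<nexists>a. \<rho> = return borel a)"

(* Since ln 0 = 0 and non-integrable functions have integral 0 here, this is the logarithmic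
   potential only where the integral converges, in particular outside the support. *)
definition log_potential :: "real measure \<Rightarrow> real \<Rightarrow> real" where
  "log_potential \<rho> z = (\<integral>x. ln \<bar>z - x\<bar> \<partial>\<rho>)"

definition Stieltjes :: "real measure \<Rightarrow> real \<Rightarrow> real" where
  "Stieltjes \<rho> z = (\<integral>x. 1 / (x - z) \<partial>\<rho>)"

definition Stieltjes_minus :: "real measure \<Rightarrow> ereal" where
  "Stieltjes_minus \<rho> = Lim (at_left (supp_minus \<rho>)) (\<lambda>z. ereal (Stieltjes \<rho> z))"

definition Stieltjes_plus :: "real measure \<Rightarrow> ereal" where
  "Stieltjes_plus \<rho> = Lim (at_right (supp_plus \<rho>)) (\<lambda>z. ereal (Stieltjes \<rho> z))"

definition Stieltjes_inv :: "real measure \<Rightarrow> real \<Rightarrow> real" where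
  "Stieltjes_inv \<rho> = the_inv_into (- {supp_minus \<rho>..supp_plus \<rho>}) (Stieltjes \<rho>)"

definition Dhat :: "real measure \<Rightarrow> real set" where
  "Dhat \<rho> = {t. - Stieltjes_minus \<rho> < ereal t \<and> ereal t < - Stieltjes_plus \<rho>}"

definition Rhat :: "real measure \<Rightarrow> real \<Rightarrow> real" where
  "Rhat \<rho> t = Stieltjes_inv \<rho> (- t) - 1 / t"

definition real_analytic_on :: "(real \<Rightarrow> real) \<Rightarrow> real set \<Rightarrow> bool" where
  "real_analytic_on f S \<longleftrightarrow> (\<forall>x\<in>S. \<exists>F. (\<lambda>h. f (x + h)) has_fps_expansion F)"

definition R_extension :: "real measure \<Rightarrow> real set \<Rightarrow> (real \<Rightarrow> real) \<Rightarrow> bool" where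
  "R_extension \<rho> I f \<longleftrightarrow>
     open I \<and> is_interval I \<and> Dhat \<rho> \<subseteq> I \<and> real_analytic_on f I \<and>
     (\<forall>t\<in>Dhat \<rho> - {0}. f t = Rhat \<rho> t)"

(* Any two extensions agree on the intersection of their intervals (an interval containing
   Dhat), by the identity theorem. Hence they glue, and the union below is itself
   the largest open interval carrying an extension. *)
definition R_domain :: "real measure \<Rightarrow> real set" where
  "R_domain \<rho> = \<Union>{I. \<exists>f. R_extension \<rho> I f}"

(* Uniquely determined on R_domain; unspecified elsewhere. *)
definition R_transform :: "real measure \<Rightarrow> real \<Rightarrow> real" where
  "R_transform \<rho> = (SOME f. R_extension \<rho> (R_domain \<rho>) f)"

(* The defining property of the free additive convolution. By Voiculescu exactly one such measure
   exists; that is not proved here, so the convolution is a relation rather than a THE term. *)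
definition is_free_convolution :: "real measure \<Rightarrow> real measure \<Rightarrow> real measure \<Rightarrow> bool" where
  "is_free_convolution \<mu> \<nu> \<rho> \<longleftrightarrow>
     compact_prob \<rho> \<and> R_domain \<mu> \<inter> R_domain \<nu> \<subseteq> R_domain \<rho> \<and>
     (\<forall>t \<in> R_domain \<mu> \<inter> R_domain \<nu>. R_transform \<rho> t = R_transform \<mu> t + R_transform \<nu> t)"

definition E_set :: "real measure \<Rightarrow> real measure \<Rightarrow> real \<Rightarrow> real set" where
  "E_set \<mu> \<nu> z = {g. - g \<in> R_domain \<mu> \<and> z - R_transform \<mu> (- g) < supp_minus \<nu>}"

definition Ehat_set :: "real measure \<Rightarrow> real measure \<Rightarrow> real \<Rightarrow> real set" where
  "Ehat_set \<mu> \<nu> z = {g. - g \<in> Dhat \<mu> \<and> z - R_transform \<mu> (- g) < supp_minus \<nu>}"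

definition E_fun :: "real measure \<Rightarrow> real measure \<Rightarrow> real \<Rightarrow> real \<Rightarrow> real" where
  "E_fun \<mu> \<nu> z g =
     (LBINT s=ereal 0..ereal g. s * deriv (R_transform \<mu>) (- s)) +
     (\<integral>x. ln (x - z + R_transform \<mu> (- g)) \<partial>\<nu>)"

end

theory Submission
  imports Defs "HOL-Complex_Analysis.Complex_Analysis"
begin

text \<open>
  Write \<open>K\<close> for the inverse of the Stieltjes transform \<open>G\<close> to the left of the support, so that
  \<open>R(-g) = K(g) + 1/g\<close>. The definition of the free convolution gives
  \<open>K\<^sub>\<rho>(g) = K\<^sub>\<mu>(g) + K\<^sub>\<nu>(g) + 1/g\<close> for all \<open>g > 0\<close> in the range of all three Stieltjes transforms.
  The crucial point is that the range for \<open>\<rho>\<close> is contained in the other two, which also makes the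
  two sets over which the infimum is taken equal.

  To see this, expand at one point \<open>z\<close> far to the left the subordination functions
  \<open>w = K\<^sub>\<mu> \<circ> G\<^sub>\<rho>\<close> and \<open>v = K\<^sub>\<nu> \<circ> G\<^sub>\<rho>\<close>. They satisfy
  \<open>-1/G\<^sub>\<mu>(w) = -1/G\<^sub>\<nu>(v) = w + v - z\<close>. The Taylor coefficients of a Stieltjes transform are
  log-convex, so by Kaluza's theorem those of \<open>-1/G\<close> are nonnegative from index 1 on, and the first is
  at least 1. By induction all coefficients of \<open>w\<close> and \<open>v\<close> are then nonnegative, hence
  dominated by those of \<open>z - 1/G\<^sub>\<rho>\<close>, and the series of \<open>w\<close> converges up to the support of \<open>\<rho>\<close>. The
  rearranged series of \<open>G\<^sub>\<mu> \<circ> w = G\<^sub>\<rho>\<close> converges as well, which forces \<open>w\<close> to stay to the left of the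
  support of \<open>\<mu>\<close>.

  Integrating \<open>s R\<^sub>\<mu>'(-s)\<close> then yields
  \<open>E(g) = U\<^sub>\<rho>(K\<^sub>\<rho>(g)) - U\<^sub>\<nu>(K\<^sub>\<nu>(g)) + U\<^sub>\<nu>(z - c)\<close> with \<open>c = R\<^sub>\<mu>(-g)\<close>. Since
  \<open>K\<^sub>\<nu>(g) = K\<^sub>\<rho>(g) - c\<close>, this is \<open>U\<^sub>\<rho>(z) + \<phi>(K\<^sub>\<rho>(g)) - \<phi>(z)\<close> for \<open>\<phi>(s) = U\<^sub>\<rho>(s) - U\<^sub>\<nu>(s - c)\<close>, and strict
  monotonicity of \<open>R\<^sub>\<mu>\<close> shows that \<open>\<phi>\<close> has its strict maximum at \<open>K\<^sub>\<rho>(g)\<close>.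
\<close>

section \<open>Real analytic functions of one variable\<close>

text \<open>Composition and local inversion of expansions are carried out for holomorphic functions
  and then restricted to the real axis.\<close>

definition complex_fps :: "real fps \<Rightarrow> complex fps" where
  "complex_fps F = Abs_fps (\<lambda>n. complex_of_real (fps_nth F n))"

lemma fps_nth_complex_fps [simp]: "fps_nth (complex_fps F) n = complex_of_real (fps_nth F n)"
  by (simp add: complex_fps_def)

lemma fps_conv_radius_complex_fps [simp]: "fps_conv_radius (complex_fps F) = fps_conv_radius F"
  by (simp add: fps_conv_radius_def conv_radius_def)

lemma eval_complex_fps:
  assumes "ereal \<bar>x\<bar> < fps_conv_radius F"
  shows "eval_fps (complex_fps F) (of_real x) = of_real (eval_fps F x)"
proof -
  have "(\<lambda>n. fps_nth F n * x ^ n) sums eval_fps F x"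
    using assms by (intro sums_eval_fps) auto
  from sums_of_real[OF this, where 'a=complex] show ?thesis
    by (simp add: eval_fps_def sums_iff)
qed

lemma complex_fps_mult: "complex_fps (F * G) = complex_fps F * complex_fps G"
  by (simp add: fps_eq_iff fps_mult_nth)

lemma complex_fps_power: "complex_fps (F ^ n) = complex_fps F ^ n"
proof (induction n)
  case 0
  show ?case by (simp add: fps_eq_iff)
next
  case (Suc n)
  then show ?case by (simp add: complex_fps_mult)
qed

lemma complex_fps_compose: "complex_fps (F oo G) = complex_fps F oo complex_fps G"
  by (simp add: fps_eq_iff fps_compose_nth flip: complex_fps_power)

lemma has_fps_expansion_imp_eventually_complex:
  fixes f :: "real \<Rightarrow> real"
  assumes "f has_fps_expansion F"
  shows "eval_fps (complex_fps F) has_fps_expansion complex_fps F"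
    and "eventually (\<lambda>x. eval_fps (complex_fps F) (of_real x) = of_real (f x)) (nhds 0)"
proof -
  show "eval_fps (complex_fps F) has_fps_expansion complex_fps F"
    using assms by (simp add: has_fps_expansion_def)
  have "eventually (\<lambda>x. x \<in> eball 0 (fps_conv_radius F)) (nhds (0::real))"
    using assms by (intro eventually_nhds_in_open) (auto simp: has_fps_expansion_def zero_ereal_def)
  moreover have "eventually (\<lambda>x. eval_fps F x = f x) (nhds 0)"
    using assms by (simp add: has_fps_expansion_def)
  ultimately show "eventually (\<lambda>x. eval_fps (complex_fps F) (of_real x) = of_real (f x)) (nhds 0)"
    by eventually_elim (simp add: eval_complex_fps)
qed

text \<open>Continuity refers to the punctured filter \<open>at x\<close>, while expansions hold on
  \<open>nhds 0\<close> including the centre; this form allows substitution there.\<close>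

lemma isCont_imp_filterlim_nhds:
  assumes "isCont f x"
  shows "filterlim f (nhds (f x)) (nhds x)"
  unfolding tendsto_def
proof safe
  fix S assume S: "open S" "f x \<in> S"
  with assms have "eventually (\<lambda>y. f y \<in> S) (at x)"
    by (auto simp: isCont_def tendsto_def)
  then show "eventually (\<lambda>y. f y \<in> S) (nhds x)"
    unfolding eventually_at_filter by eventually_elim (use S in auto)
qed

text \<open>The way back from the complex plane: on the real axis the complexified series has the
  real sums, and \<open>of_real\<close> is injective.\<close>

lemma has_fps_expansion_realI:
  fixes f :: "real \<Rightarrow> real"
  assumes "h has_fps_expansion complex_fps F"
    and "eventually (\<lambda>x. h (of_real x) = of_real (f x)) (nhds 0)"
  shows "f has_fps_expansion F"
proof -
  have r: "fps_conv_radius F > 0" and ev: "eventually (\<lambda>z. eval_fps (complex_fps F) z = h z) (nhds 0)"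
    using assms(1) by (auto simp: has_fps_expansion_def)
  have "filterlim complex_of_real (nhds 0) (nhds 0)"
    using isCont_imp_filterlim_nhds[of 0 complex_of_real] by simp
  hence "eventually (\<lambda>x. eval_fps (complex_fps F) (of_real x) = h (of_real x)) (nhds (0::real))"
    using ev by (rule eventually_compose_filterlim[rotated])
  moreover have "eventually (\<lambda>x. x \<in> eball 0 (fps_conv_radius F)) (nhds (0::real))"
    using r by (intro eventually_nhds_in_open) (auto simp: zero_ereal_def)
  ultimately have "eventually (\<lambda>x. eval_fps F x = f x) (nhds 0)"
    using assms(2)
  proof eventually_elim
    case (elim x)
    then have "complex_of_real (eval_fps F x) = of_real (f x)"
      by (simp add: eval_complex_fps)
    then show ?case by (simp only: of_real_eq_iff)
  qed
  with r show ?thesis by (simp add: has_fps_expansion_def)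
qed

lemma has_fps_expansion_nth_0:
  fixes f :: "real \<Rightarrow> real"
  assumes "f has_fps_expansion F"
  shows "fps_nth F 0 = f 0"
  using assms by (auto simp: has_fps_expansion_def eval_fps_at_0 dest: eventually_nhds_x_imp_x)

lemma has_fps_expansion_compose_real:
  fixes f g :: "real \<Rightarrow> real"
  assumes F: "f has_fps_expansion F" and G: "g has_fps_expansion G" and G0: "fps_nth G 0 = 0"
  shows "(\<lambda>x. f (g x)) has_fps_expansion (F oo G)"
proof (rule has_fps_expansion_realI)
  let ?f = "eval_fps (complex_fps F)" and ?g = "eval_fps (complex_fps G)"
  show "(?f \<circ> ?g) has_fps_expansion complex_fps (F oo G)"
    unfolding complex_fps_compose
    by (intro has_fps_expansion_compose has_fps_expansion_imp_eventually_complex[OF F]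
        has_fps_expansion_imp_eventually_complex[OF G]) (use G0 in auto)
  have "continuous (at 0) g"
    using has_fps_expansion_imp_continuous[OF G, of UNIV] by simp
  hence "filterlim g (nhds 0) (nhds 0)"
    using has_fps_expansion_nth_0[OF G] G0 isCont_imp_filterlim_nhds[of 0 g] by simp
  hence "eventually (\<lambda>x. ?f (of_real (g x)) = of_real (f (g x))) (nhds 0)"
    using has_fps_expansion_imp_eventually_complex(2)[OF F] by (rule eventually_compose_filterlim[rotated])
  with has_fps_expansion_imp_eventually_complex(2)[OF G]
  show "eventually (\<lambda>x. (?f \<circ> ?g) (of_real x) = of_real (f (g x))) (nhds 0)"
    by eventually_elim simp
qed

text \<open>Zeros of a nonzero analytic function are isolated: dividing by \<open>x ^ n\<close>,
  with \<open>n\<close> the order of the zero, leaves a function that is continuous and nonzero at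
  0.\<close>

lemma has_fps_expansion_frequently_0_imp_0:
  fixes f :: "real \<Rightarrow> real"
  assumes F: "f has_fps_expansion F" and freq: "frequently (\<lambda>x. f x = 0) (at 0)"
  shows "F = 0"
proof (rule ccontr)
  assume "F \<noteq> 0"
  then have n: "fps_nth F (subdegree F) \<noteq> 0" by simp
  define n where "n = subdegree F"
  have *: "(\<lambda>x. if x = 0 then fps_nth F n else f x / x ^ n) has_fps_expansion fps_shift n F"
    by (rule has_fps_expansion_shift[OF F]) (auto simp: n_def)
  have "isCont (\<lambda>x. if x = 0 then fps_nth F n else f x / x ^ n) 0"
    using has_fps_expansion_imp_continuous[OF *, of UNIV] by simp
  then have "((\<lambda>x. if x = 0 then fps_nth F n else f x / x ^ n) \<longlongrightarrow> fps_nth F n) (at 0)"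
    by (simp add: isCont_def)
  then have "eventually (\<lambda>x. (if x = 0 then fps_nth F n else f x / x ^ n) \<noteq> 0) (at 0)"
    using n unfolding n_def by (rule tendsto_imp_eventually_ne)
  moreover have "eventually (\<lambda>x::real. x \<noteq> 0) (at 0)" by (simp add: eventually_at_filter)
  ultimately have "eventually (\<lambda>x. f x \<noteq> 0) (at 0)"
    by eventually_elim auto
  with freq show False by (simp add: frequently_def)
qed

lemma has_fps_expansion_unique_real:
  fixes f :: "real \<Rightarrow> real"
  assumes "f has_fps_expansion F" "f has_fps_expansion G"
  shows "F = G"
proof -
  have "(\<lambda>x. f x - f x) has_fps_expansion (F - G)"
    using assms by (rule has_fps_expansion_diff)
  then have "F - G = 0"
    by (rule has_fps_expansion_frequently_0_imp_0) (simp add: frequently_def)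
  then show ?thesis by simp
qed

text \<open>A nonzero derivative makes the sum of \<open>F\<close> injective near 0. The expansion
  of its holomorphic inverse is a compositional left inverse of \<open>F\<close>, and there is only
  one, namely \<open>fps_inv F\<close>.\<close>

lemma fps_conv_radius_fps_inv_pos_complex:
  fixes F :: "complex fps"
  assumes r: "fps_conv_radius F > 0" and F0: "fps_nth F 0 = 0" and F1: "fps_nth F 1 \<noteq> 0"
  shows "fps_conv_radius (fps_inv F) > 0"
proof -
  define f where "f = eval_fps F"
  have F: "f has_fps_expansion F" unfolding f_def using r by (rule eval_fps_has_fps_expansion)
  obtain s where s: "open s" "0 \<in> s" "f holomorphic_on s"
    using has_fps_expansion_imp_holomorphic[OF F] by metis
  have "deriv f 0 = fps_nth F 1"
    using fps_nth_fps_expansion[OF F, of 1] by simp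
  with F1 obtain d where d: "d > 0" "ball 0 d \<subseteq> s" "open (f ` ball 0 d)" "inj_on f (ball 0 d)"
    using has_complex_derivative_locally_invertible[OF s(3,2,1)] by metis
  have hol: "f holomorphic_on ball 0 d" using s(3) d(2) by (rule holomorphic_on_subset)
  obtain g where g: "g holomorphic_on (f ` ball 0 d)" "\<And>z. z \<in> ball 0 d \<Longrightarrow> g (f z) = z"
    using holomorphic_has_inverse[OF hol open_ball d(4)] by metis
  have f0: "f 0 = 0" using F0 by (simp add: f_def eval_fps_at_0)
  have "g analytic_on {0}"
    using g(1) d(1,3) f0 by (auto simp: analytic_at intro!: exI[of _ "f ` ball 0 d"] image_eqI[of _ _ 0])
  then have G: "g has_fps_expansion fps_expansion g 0" by (rule analytic_at_imp_has_fps_expansion_0)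
  have "(g \<circ> f) has_fps_expansion (fps_expansion g 0 oo F)"
    using G F F0 by (rule has_fps_expansion_compose)
  moreover have "(g \<circ> f) has_fps_expansion fps_X"
  proof -
    have "eventually (\<lambda>z. z \<in> ball 0 d) (nhds (0::complex))"
      using d(1) by (intro eventually_nhds_in_open) auto
    then have "eventually (\<lambda>z. z = (g \<circ> f) z) (nhds 0)"
      by eventually_elim (simp add: g(2))
    from has_fps_expansion_cong[OF this refl, THEN iffD1, OF has_fps_expansion_fps_X] show ?thesis .
  qed
  ultimately have "fps_expansion g 0 oo F = fps_X" by (rule fps_expansion_unique_complex)
  also have "\<dots> = fps_inv F oo F" using fps_inv[OF F0 F1] by simp
  finally have "fps_expansion g 0 = fps_inv F" using fps_compose_inj_right[OF F0 F1] by blast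
  with G show ?thesis by (simp add: has_fps_expansion_def)
qed

text \<open>By uniqueness of compositional inverses, \<open>complex_fps\<close> commutes with
  \<open>fps_inv\<close>, so the radius carries over from the complex case.\<close>

lemma fps_conv_radius_fps_inv_pos:
  fixes F :: "real fps"
  assumes "fps_conv_radius F > 0" and F0: "fps_nth F 0 = 0" and F1: "fps_nth F 1 \<noteq> 0"
  shows "fps_conv_radius (fps_inv F) > 0"
proof -
  have "complex_fps (fps_inv F) oo complex_fps F = complex_fps (fps_inv F oo F)"
    by (simp add: complex_fps_compose)
  also have "fps_inv F oo F = fps_X" using F0 F1 by (rule fps_inv)
  also have "complex_fps fps_X = fps_X" by (simp add: fps_eq_iff fps_X_def)
  also have "\<dots> = fps_inv (complex_fps F) oo complex_fps F"
    by (rule fps_inv[symmetric]) (use F0 F1 in auto)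
  finally have "complex_fps (fps_inv F) = fps_inv (complex_fps F)"
    by (subst (asm) fps_compose_inj_right) (use F0 F1 in auto)
  moreover have "fps_conv_radius (fps_inv (complex_fps F)) > 0"
    using assms by (intro fps_conv_radius_fps_inv_pos_complex) auto
  ultimately show ?thesis by (metis fps_conv_radius_complex_fps)
qed

section \<open>Calculus of real analyticity at a point\<close>

abbreviation real_analytic_at :: "(real \<Rightarrow> real) \<Rightarrow> real \<Rightarrow> bool" where
  "real_analytic_at f x \<equiv> real_analytic_on f {x}"

lemma real_analytic_atI: "(\<lambda>h. f (x + h)) has_fps_expansion F \<Longrightarrow> real_analytic_at f x"
  by (auto simp: real_analytic_on_def)

lemma real_analytic_on_iff_at: "real_analytic_on f S \<longleftrightarrow> (\<forall>x\<in>S. real_analytic_at f x)"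
  by (auto simp: real_analytic_on_def)

lemma eventually_nhds_shift: "eventually P (nhds (x::real)) \<longleftrightarrow> eventually (\<lambda>h. P (x + h)) (nhds 0)"
  by (subst nhds_to_0) (simp add: eventually_filtermap add.commute)

lemma real_analytic_at_cong:
  assumes "real_analytic_at f x" "eventually (\<lambda>y. f y = g y) (nhds x)"
  shows "real_analytic_at g x"
proof -
  obtain F where F: "(\<lambda>h. f (x + h)) has_fps_expansion F"
    using assms(1) by (auto simp: real_analytic_on_def)
  have "eventually (\<lambda>h. f (x + h) = g (x + h)) (nhds 0)"
    using assms(2) by (simp add: eventually_nhds_shift[of _ x])
  from has_fps_expansion_cong[OF this refl] F show ?thesis by (auto intro: real_analytic_atI)
qed

text \<open>The inverse series sums to a function \<open>\<gamma>\<close> with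
  \<open>f (x + \<gamma> h) = f x + h\<close>. Applying the left inverse \<open>k\<close> to this
  equation identifies \<open>k\<close> with an analytic function.\<close>

lemma real_analytic_at_inverse_fun:
  fixes f k :: "real \<Rightarrow> real"
  assumes F: "(\<lambda>h. f (x + h)) has_fps_expansion F" and F1: "fps_nth F 1 \<noteq> 0"
    and k: "eventually (\<lambda>y. k (f y) = y) (nhds x)"
  shows "(\<lambda>h. k (f x + h) - x) has_fps_expansion fps_inv (F - fps_const (f x))"
proof -
  let ?F = "F - fps_const (f x)"
  define G where "G = fps_inv ?F"
  have F': "(\<lambda>h. f (x + h) - f x) has_fps_expansion ?F"
    by (intro has_fps_expansion_diff F has_fps_expansion_const)
  have F0: "fps_nth ?F 0 = 0" using has_fps_expansion_nth_0[OF F'] by simp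
  have F1': "fps_nth ?F 1 \<noteq> 0" using F1 by simp
  have "fps_conv_radius G > 0"
    unfolding G_def using F' F0 F1'
    by (intro fps_conv_radius_fps_inv_pos) (auto simp: has_fps_expansion_def)
  then have G: "eval_fps G has_fps_expansion G" by (rule eval_fps_has_fps_expansion)
  have G0: "fps_nth G 0 = 0" by (simp add: G_def fps_inv_def)
  have "(\<lambda>h. f (x + eval_fps G h) - f x) has_fps_expansion (?F oo G)"
    using has_fps_expansion_compose_real[OF F' G G0] .
  also have "?F oo G = fps_X" unfolding G_def using F0 F1' by (rule fps_inv_right)
  finally have "eventually (\<lambda>h. f (x + eval_fps G h) - f x = h) (nhds 0)"
    by (simp add: has_fps_expansion_def eq_commute)
  moreover have "filterlim (eval_fps G) (nhds 0) (nhds 0)"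
    using has_fps_expansion_imp_continuous[OF G, of UNIV] G0
      isCont_imp_filterlim_nhds[of 0 "eval_fps G"] by (simp add: eval_fps_at_0)
  then have "eventually (\<lambda>h. k (f (x + eval_fps G h)) = x + eval_fps G h) (nhds 0)"
    using k[unfolded eventually_nhds_shift[of _ x]] by (rule eventually_compose_filterlim[rotated])
  ultimately have "eventually (\<lambda>h. eval_fps G h = k (f x + h) - x) (nhds 0)"
  proof eventually_elim
    case (elim h)
    then have "f (x + eval_fps G h) = f x + h" by simp
    with elim(2) show ?case by simp
  qed
  from has_fps_expansion_cong[OF this refl] G show ?thesis by (simp add: G_def)
qed

lemma has_fps_expansion_imp_has_real_derivative:
  assumes "(\<lambda>h. f (x + h)) has_fps_expansion F"
  shows "(f has_real_derivative fps_nth F 1) (at x)"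
proof -
  have r: "fps_conv_radius F > 0" and ev: "eventually (\<lambda>h. eval_fps F h = f (x + h)) (nhds 0)"
    using assms by (auto simp: has_fps_expansion_def)
  have "(eval_fps F has_field_derivative eval_fps (fps_deriv F) 0) (at 0)"
    using r by (intro has_field_derivative_eval_fps) (auto simp: zero_ereal_def)
  also have "?this \<longleftrightarrow> ((\<lambda>h. f (x + h)) has_field_derivative fps_nth F 1) (at 0)"
    using ev by (intro DERIV_cong_ev) (auto simp: eval_fps_at_0)
  finally show ?thesis using DERIV_shift[of f _ 0 x] by (simp add: add.commute)
qed


lemma real_analytic_atE:
  assumes "real_analytic_at f x"
  obtains F where "(\<lambda>h. f (x + h)) has_fps_expansion F"
  using assms by (auto simp: real_analytic_on_def)

lemma real_analytic_at_ident: "real_analytic_at (\<lambda>t. t) x"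
  using has_fps_expansion_add[OF has_fps_expansion_const has_fps_expansion_fps_X]
  by (rule real_analytic_atI)

lemma real_analytic_at_minus:
  assumes "real_analytic_at f x"
  shows "real_analytic_at (\<lambda>t. - f t) x"
proof -
  from assms obtain F where F: "(\<lambda>h. f (x + h)) has_fps_expansion F" by (rule real_analytic_atE)
  show ?thesis by (rule real_analytic_atI[OF has_fps_expansion_minus[OF F]])
qed

lemma real_analytic_at_diff:
  assumes "real_analytic_at f x" "real_analytic_at g x"
  shows "real_analytic_at (\<lambda>t. f t - g t) x"
proof -
  from assms(1) obtain F where F: "(\<lambda>h. f (x + h)) has_fps_expansion F" by (rule real_analytic_atE)
  from assms(2) obtain G where G: "(\<lambda>h. g (x + h)) has_fps_expansion G" by (rule real_analytic_atE)
  show ?thesis by (rule real_analytic_atI[OF has_fps_expansion_diff[OF F G]])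
qed

lemma real_analytic_at_inverse:
  assumes "real_analytic_at f x" "f x \<noteq> 0"
  shows "real_analytic_at (\<lambda>t. inverse (f t)) x"
proof -
  from assms(1) obtain F where F: "(\<lambda>h. f (x + h)) has_fps_expansion F" by (rule real_analytic_atE)
  have "fps_nth F 0 \<noteq> 0" using has_fps_expansion_nth_0[OF F] assms(2) by simp
  from has_fps_expansion_inverse[OF F this] show ?thesis by (rule real_analytic_atI)
qed

lemma real_analytic_at_compose:
  assumes "real_analytic_at g x" "real_analytic_at f (g x)"
  shows "real_analytic_at (\<lambda>t. f (g t)) x"
proof -
  from assms(1) obtain G where G: "(\<lambda>h. g (x + h)) has_fps_expansion G" by (rule real_analytic_atE)
  from assms(2) obtain F where F: "(\<lambda>h. f (g x + h)) has_fps_expansion F" by (rule real_analytic_atE)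
  have G': "(\<lambda>h. g (x + h) - g x) has_fps_expansion (G - fps_const (g x))"
    by (intro has_fps_expansion_diff G has_fps_expansion_const)
  have "fps_nth (G - fps_const (g x)) 0 = 0" using has_fps_expansion_nth_0[OF G'] by simp
  from has_fps_expansion_compose_real[OF F G' this] show ?thesis
    by (intro real_analytic_atI) simp
qed

lemma real_analytic_at_reflect:
  "real_analytic_at f (- x) \<Longrightarrow> real_analytic_at (\<lambda>t. f (- t)) x"
  by (rule real_analytic_at_compose[OF real_analytic_at_minus[OF real_analytic_at_ident]])

lemma real_analytic_at_imp_DERIV:
  assumes "real_analytic_at f x"
  shows "(f has_real_derivative deriv f x) (at x)"
proof -
  from assms obtain F where F: "(\<lambda>h. f (x + h)) has_fps_expansion F" by (rule real_analytic_atE)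
  from has_fps_expansion_imp_has_real_derivative[OF this] show ?thesis
    using DERIV_imp_deriv by metis
qed

lemma real_analytic_at_deriv:
  assumes "real_analytic_at f x"
  shows "real_analytic_at (deriv f) x"
proof -
  from assms obtain F where F: "(\<lambda>h. f (x + h)) has_fps_expansion F" by (rule real_analytic_atE)
  have "deriv (\<lambda>h. f (x + h)) = (\<lambda>h. deriv f (x + h))"
    unfolding deriv_def using DERIV_shift[of f _ _ x] by (simp add: add.commute)
  with has_fps_expansion_deriv[OF F] show ?thesis by (intro real_analytic_atI) simp
qed

lemma real_analytic_at_imp_isCont: "real_analytic_at f x \<Longrightarrow> isCont f x"
  using real_analytic_at_imp_DERIV DERIV_isCont by blast

section \<open>Identity theorem and the maximal analytic extension\<close>

text \<open>Connectedness: the set where the functions agree locally and the set where they differ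
  on a punctured neighbourhood are open and disjoint, and they cover \<open>I\<close> because zeros
  of the difference are isolated.\<close>

lemma real_analytic_identity_theorem:
  fixes f g :: "real \<Rightarrow> real"
  assumes I: "open I" "is_interval I"
    and f: "real_analytic_on f I" and g: "real_analytic_on g I"
    and t0: "t0 \<in> I" "frequently (\<lambda>t. f t = g t) (at t0)" and t: "t \<in> I"
  shows "f t = g t"
proof -
  have dich: "eventually (\<lambda>t. f t = g t) (nhds s)"
    if "s \<in> I" "frequently (\<lambda>t. f t = g t) (at s)" for s
  proof -
    have "real_analytic_at (\<lambda>t. f t - g t) s"
      using f g that by (intro real_analytic_at_diff) (auto simp: real_analytic_on_def)
    then obtain F where F: "(\<lambda>h. f (s + h) - g (s + h)) has_fps_expansion F"
      by (rule real_analytic_atE)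
    have "frequently (\<lambda>h. f (s + h) - g (s + h) = 0) (at 0)"
      using that(2) by (subst (asm) at_to_0) (simp add: frequently_def eventually_filtermap add.commute)
    with F have "F = 0" by (rule has_fps_expansion_frequently_0_imp_0)
    with F have "eventually (\<lambda>h. f (s + h) - g (s + h) = 0) (nhds 0)"
      by (simp add: has_fps_expansion_0_iff)
    then show ?thesis by (simp add: eventually_nhds_shift[of _ s])
  qed
  define A where "A = {s. eventually (\<lambda>t. f t = g t) (nhds s)}"
  define B where "B = {s. eventually (\<lambda>t. f t \<noteq> g t) (at s)}"
  have "open A"
    unfolding A_def by (subst open_subopen) (auto simp: eventually_nhds)
  moreover have "open B"
    unfolding B_def
  proof (subst open_subopen, safe)
    fix s assume "eventually (\<lambda>t. f t \<noteq> g t) (at s)"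
    then obtain S where S: "open S" "s \<in> S" "\<And>t. t \<in> S \<Longrightarrow> t \<noteq> s \<Longrightarrow> f t \<noteq> g t"
      by (auto simp: eventually_at_topological)
    have "eventually (\<lambda>t. f t \<noteq> g t) (at u)" if "u \<in> S" for u
    proof (cases "u = s")
      case True
      with S show ?thesis by (auto simp: eventually_at_topological)
    next
      case False
      with S that show ?thesis
        unfolding eventually_at_topological by (intro exI[of _ "S - {s}"]) (auto intro: open_delete)
    qed
    with S show "\<exists>T. open T \<and> s \<in> T \<and> T \<subseteq> {s. eventually (\<lambda>t. f t \<noteq> g t) (at s)}"
      by blast
  qed
  moreover have "A \<inter> B \<inter> I = {}"
  proof -
    have False if "s \<in> A" "s \<in> B" for s
    proof -
      have "eventually (\<lambda>t. f t = g t) (at s)"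
        using that by (auto simp: A_def eventually_at_filter elim: eventually_mono)
      moreover have "eventually (\<lambda>t. f t \<noteq> g t) (at s)" using that by (simp add: B_def)
      ultimately have "eventually (\<lambda>t. False) (at s)" by eventually_elim simp
      then show False by simp
    qed
    then show ?thesis by blast
  qed
  moreover have "I \<subseteq> A \<union> B"
    using dich by (auto simp: A_def B_def frequently_def)
  moreover have "connected I" using I(2) by (simp add: is_interval_connected)
  ultimately have "A \<inter> I = {} \<or> B \<inter> I = {}" by (intro connectedD)
  moreover have "t0 \<in> A" using dich t0 by (auto simp: A_def)
  ultimately have "t \<in> A" using t t0(1) \<open>I \<subseteq> A \<union> B\<close> by blast
  then show ?thesis by (auto simp: A_def dest: eventually_nhds_x_imp_x)
qed

text \<open>Both extensions equal \<open>Rhat\<close> on a punctured neighbourhood of 0, the point 0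
  itself being left open by the definition, and the intersection of the two intervals is again an
  interval.\<close>

lemma R_extension_agree:
  assumes D: "open (Dhat \<rho>)" "0 \<in> Dhat \<rho>"
    and f: "R_extension \<rho> I f" and g: "R_extension \<rho> J g" and t: "t \<in> I" "t \<in> J"
  shows "f t = g t"
proof (rule real_analytic_identity_theorem[of "I \<inter> J" f g 0 t])
  show "open (I \<inter> J)" "is_interval (I \<inter> J)"
    using f g by (auto simp: R_extension_def is_interval_Int)
  show "real_analytic_on f (I \<inter> J)" "real_analytic_on g (I \<inter> J)"
    using f g by (auto simp: R_extension_def real_analytic_on_def)
  show "t \<in> I \<inter> J" "0 \<in> I \<inter> J" using t f g D by (auto simp: R_extension_def)
  have "eventually (\<lambda>t. t \<in> Dhat \<rho>) (at 0)"
    using D by (rule eventually_at_in_open')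
  moreover have "eventually (\<lambda>t::real. t \<noteq> 0) (at 0)" by (simp add: eventually_at_filter)
  ultimately have "eventually (\<lambda>t. f t = g t) (at 0)"
    by eventually_elim (use f g in \<open>auto simp: R_extension_def\<close>)
  then show "frequently (\<lambda>t. f t = g t) (at 0)"
    by (intro eventually_frequently) auto
qed

text \<open>All intervals contain 0, so their union is an interval; the extensions agree on overlaps
  and glue. This gives the choice in \<open>R_transform\<close> a witness.\<close>

lemma R_extension_R_domain:
  assumes D: "open (Dhat \<rho>)" "0 \<in> Dhat \<rho>" and ex: "R_extension \<rho> I0 f0"
  shows "R_extension \<rho> (R_domain \<rho>) (R_transform \<rho>)"
proof -
  \<comment> \<open>The chosen value does not depend on the extension, by
    \<open>R_extension_agree\<close>.\<close>
  define F where "F t = (SOME y. \<exists>I f. R_extension \<rho> I f \<and> t \<in> I \<and> f t = y)" for t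
  have F: "F t = f t" if "R_extension \<rho> I f" "t \<in> I" for I f t
  proof -
    have "\<exists>I g. R_extension \<rho> I g \<and> t \<in> I \<and> g t = F t"
      unfolding F_def by (rule someI[of _ "f t"]) (use that in blast)
    with R_extension_agree[OF D] that show ?thesis by metis
  qed
  have "R_extension \<rho> (R_domain \<rho>) F"
    unfolding R_extension_def
  proof (intro conjI ballI)
    show "open (R_domain \<rho>)"
      by (auto simp: R_domain_def R_extension_def)
    have "connected (R_domain \<rho>)"
      unfolding R_domain_def
    proof (rule connected_Union)
      show "connected I" if "I \<in> {I. \<exists>f. R_extension \<rho> I f}" for I
        using that by (auto simp: R_extension_def is_interval_connected)
      have "0 \<in> \<Inter> {I. \<exists>f. R_extension \<rho> I f}"
        using D(2) by (auto simp: R_extension_def)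
      then show "\<Inter> {I. \<exists>f. R_extension \<rho> I f} \<noteq> {}" by blast
    qed
    then show "is_interval (R_domain \<rho>)" by (simp add: is_interval_connected_1)
    show "Dhat \<rho> \<subseteq> R_domain \<rho>"
      using ex by (force simp: R_domain_def R_extension_def)
    show "real_analytic_on F (R_domain \<rho>)"
      proof (rule real_analytic_on_iff_at[THEN iffD2], rule ballI)
      fix t assume "t \<in> R_domain \<rho>"
      then obtain I f where f: "R_extension \<rho> I f" "t \<in> I" by (auto simp: R_domain_def)
      have "eventually (\<lambda>s. s \<in> I) (nhds t)"
        using f by (intro eventually_nhds_in_open) (auto simp: R_extension_def)
      then have "eventually (\<lambda>s. f s = F s) (nhds t)"
        by eventually_elim (use F f in auto)
      moreover have "real_analytic_at f t"
        using f by (auto simp: R_extension_def real_analytic_on_def)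
      ultimately show "real_analytic_at F t" by (rule real_analytic_at_cong[rotated])
    qed
    fix t assume "t \<in> Dhat \<rho> - {0}"
    moreover from this have "t \<in> I0" "f0 t = Rhat \<rho> t" using ex by (auto simp: R_extension_def)
    ultimately show "F t = Rhat \<rho> t" using F[OF ex] by simp
  qed
  then show ?thesis unfolding R_transform_def by (rule someI[of "R_extension \<rho> (R_domain \<rho>)"])
qed

section \<open>Stieltjes transforms of compactly supported laws\<close>

locale compact_law = real_distribution M for M :: "real measure" +
  assumes compact_msupport: "compact (msupport M)"
begin

abbreviation "lo \<equiv> supp_minus M"
abbreviation "hi \<equiv> supp_plus M"
abbreviation "G \<equiv> Stieltjes M"

lemma prob_UNIV [simp]: "prob UNIV = 1"
  using prob_space by simp

text \<open>The complement of the support is a union of open null sets, and by Lindelof countably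
  many of them have the same union.\<close>

lemma AE_msupport: "AE x in M. x \<in> msupport M"
proof -
  define F where "F = {U :: real set. open U \<and> measure M U = 0}"
  obtain F' where F': "F' \<subseteq> F" "countable F'" "\<Union>F' = \<Union>F"
    using Lindelof[of F] by (auto simp: F_def)
  have "AE x in M. \<forall>U\<in>F'. x \<notin> U"
  proof (subst AE_ball_countable[OF F'(2)], rule ballI)
    fix U assume "U \<in> F'"
    with F'(1) have "open U" "measure M U = 0" by (auto simp: F_def)
    then show "AE x in M. x \<notin> U"
      by (intro AE_not_in) (auto simp: null_sets_def emeasure_eq_measure)
  qed
  then show ?thesis
  proof eventually_elim
    case (elim x)
    then have "x \<notin> \<Union>F" using F'(3) by auto
    then show ?case by (auto simp: msupport_def F_def zero_less_measure_iff)
  qed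
qed

lemma msupport_nonempty: "msupport M \<noteq> {}"
proof
  assume "msupport M = {}"
  then have "AE x in M. False" using AE_msupport by simp
  then show False by simp
qed

lemma lo_in_msupport: "lo \<in> msupport M"
  and msupport_bounds: "x \<in> msupport M \<Longrightarrow> lo \<le> x \<and> x \<le> hi"
proof -
  have b: "bdd_below (msupport M)" "bdd_above (msupport M)"
    using compact_msupport by (auto intro: bounded_imp_bdd_below bounded_imp_bdd_above compact_imp_bounded)
  then show "lo \<in> msupport M"
    unfolding supp_minus_def using msupport_nonempty compact_imp_closed[OF compact_msupport]
    by (auto intro: closed_contains_Inf)
  show "x \<in> msupport M \<Longrightarrow> lo \<le> x \<and> x \<le> hi"
    unfolding supp_minus_def supp_plus_def using b by (auto intro: cInf_lower cSup_upper)
qed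

lemma lo_le_hi: "lo \<le> hi"
  using msupport_bounds lo_in_msupport by blast

lemma AE_bounds: "AE x in M. lo \<le> x \<and> x \<le> hi"
  using AE_msupport by eventually_elim (rule msupport_bounds)

text \<open>Open intervals around \<open>lo\<close> carry mass because \<open>lo\<close> lies in the
  support, and none of that mass lies below \<open>lo\<close>.\<close>

lemma measure_near_lo_pos:
  assumes "e > 0"
  shows "measure M {lo..<lo + e} > 0"
proof -
  have "measure M {lo - e<..<lo + e} > 0"
    using lo_in_msupport assms by (auto simp: msupport_def)
  also have "measure M {lo - e<..<lo + e} = measure M {lo..<lo + e}"
    using AE_bounds by (intro finite_measure_eq_AE) (auto simp: assms elim!: eventually_mono)
  finally show ?thesis .
qed

lemma AE_dist_lower:
  assumes "z < lo" shows "AE x in M. lo - z \<le> \<bar>x - z\<bar>"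
  using AE_bounds by eventually_elim (use assms in auto)

lemma AE_dist_upper:
  assumes "hi < z" shows "AE x in M. z - hi \<le> \<bar>x - z\<bar>"
  using AE_bounds by eventually_elim (use assms in auto)

lemma AE_dist:
  assumes "z \<notin> {lo..hi}"
  obtains d where "d > 0" "AE x in M. d \<le> \<bar>x - z\<bar>"
  using assms AE_dist_lower[of z] AE_dist_upper[of z]
  by (cases "z < lo") (auto intro: that[of "lo - z"] that[of "z - hi"])

lemma integrable_bounded:
  assumes [measurable]: "f \<in> borel_measurable M" and "AE x in M. \<bar>f x\<bar> \<le> (C :: real)"
  shows "integrable M f"
  using assms by (intro integrable_const_bound[of _ C]) auto

section \<open>Expansion of the Stieltjes transform and its moments\<close>

text \<open>The majorant \<open>C * (\<bar>h\<bar> * Q) ^ n\<close> permits integrating the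
  geometric series term by term. It serves twice: for the Taylor series of \<open>G\<close> off the
  support interval, and with \<open>q x = - x\<close> for the expansion at infinity.\<close>

lemma integral_geometric_sums:
  fixes c q :: "real \<Rightarrow> real"
  assumes [measurable]: "c \<in> borel_measurable M" "q \<in> borel_measurable M"
    and C: "AE x in M. \<bar>c x\<bar> \<le> C" and Q: "AE x in M. \<bar>q x\<bar> \<le> Q" and h: "\<bar>h\<bar> * Q < 1"
  shows "(\<lambda>n. (\<integral>x. c x * q x ^ n \<partial>M) * h ^ n) sums (\<integral>x. c x / (1 - h * q x) \<partial>M)"
proof -
  have C0: "C \<ge> 0" and Q0: "Q \<ge> 0"
  proof -
    have "AE x in M. 0 \<le> C" using C by eventually_elim auto
    then show "C \<ge> 0" by simp
    have "AE x in M. 0 \<le> Q" using Q by eventually_elim auto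
    then show "Q \<ge> 0" by simp
  qed
  have bound: "AE x in M. \<bar>c x * q x ^ n * h ^ n\<bar> \<le> C * (\<bar>h\<bar> * Q) ^ n" for n
    using C Q
  proof eventually_elim
    case (elim x)
    have "\<bar>c x * q x ^ n * h ^ n\<bar> = \<bar>c x\<bar> * (\<bar>q x\<bar> ^ n * \<bar>h\<bar> ^ n)"
      by (simp add: abs_mult power_abs)
    also have "\<dots> \<le> C * (Q ^ n * \<bar>h\<bar> ^ n)"
      using elim C0 by (intro mult_mono power_mono mult_nonneg_nonneg) auto
    finally show ?case by (simp add: power_mult_distrib mult.commute)
  qed
  have int: "integrable M (\<lambda>x. c x * q x ^ n * h ^ n)" for n
    by (rule integrable_bounded[OF _ bound]) measurable
  have sm: "summable (\<lambda>n. C * (\<bar>h\<bar> * Q) ^ n)"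
    using h Q0 by (intro summable_mult summable_geometric) auto
  have "(\<lambda>n. \<integral>x. c x * q x ^ n * h ^ n \<partial>M) sums (\<integral>x. (\<Sum>n. c x * q x ^ n * h ^ n) \<partial>M)"
  proof (rule sums_integral[OF int])
    have "AE x in M. \<forall>n. \<bar>c x * q x ^ n * h ^ n\<bar> \<le> C * (\<bar>h\<bar> * Q) ^ n"
      using bound by (simp add: AE_all_countable)
    then show "AE x in M. summable (\<lambda>n. norm (c x * q x ^ n * h ^ n))"
      by eventually_elim (rule summable_comparison_test'[OF sm], simp)
    show "summable (\<lambda>n. \<integral>x. norm (c x * q x ^ n * h ^ n) \<partial>M)"
    proof (rule summable_comparison_test'[OF sm])
      fix n
      have "(\<integral>x. norm (c x * q x ^ n * h ^ n) \<partial>M) \<le> (\<integral>x. C * (\<bar>h\<bar> * Q) ^ n \<partial>M)"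
        by (rule integral_mono_AE) (use int bound in auto)
      then show "norm (\<integral>x. norm (c x * q x ^ n * h ^ n) \<partial>M) \<le> C * (\<bar>h\<bar> * Q) ^ n"
        by simp
    qed
  qed
  also have "(\<integral>x. (\<Sum>n. c x * q x ^ n * h ^ n) \<partial>M) = (\<integral>x. c x / (1 - h * q x) \<partial>M)"
  proof (rule integral_cong_AE)
    show "AE x in M. (\<Sum>n. c x * q x ^ n * h ^ n) = c x / (1 - h * q x)"
      using Q
    proof eventually_elim
      case (elim x)
      have "\<bar>h * q x\<bar> \<le> \<bar>h\<bar> * Q" unfolding abs_mult using elim by (intro mult_left_mono) auto
      with h have "norm (h * q x) < 1" by simp
      from sums_mult[OF geometric_sums[OF this], of "c x"] show ?case
        by (simp add: sums_iff power_mult_distrib mult_ac)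
    qed
  qed measurable
  finally show ?thesis by simp
qed

text \<open>The index is that of the Taylor coefficient of \<open>G\<close> at \<open>z\<close>, one less than the power of the resolvent.\<close>
definition mom :: "nat \<Rightarrow> real \<Rightarrow> real" where
  "mom n z = (\<integral>x. (1 / (x - z)) ^ Suc n \<partial>M)"

lemma integrable_mom:
  assumes "z \<notin> {lo..hi}"
  shows "integrable M (\<lambda>x. (1 / (x - z)) ^ n)"
proof -
  obtain d where d: "d > 0" "AE x in M. d \<le> \<bar>x - z\<bar>" using AE_dist[OF assms] .
  show ?thesis
  proof (rule integrable_bounded)
    show "AE x in M. \<bar>(1 / (x - z)) ^ n\<bar> \<le> (1 / d) ^ n"
      using d(2)
    proof eventually_elim
      case (elim x)
      then have "\<bar>1 / (x - z)\<bar> \<le> 1 / d" using d(1) by (auto simp: abs_divide intro!: divide_left_mono)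
      then show ?case by (simp only: power_abs) (intro power_mono, auto)
    qed
  qed measurable
qed

text \<open>With \<open>X = 1 / (x - z)\<close> one has
  \<open>1 / (x - (z + h)) = X / (1 - h * X)\<close>. The series thus converges at least up to the
  distance from \<open>z\<close> to the mass, which matters later when it is followed up to the
  endpoint.\<close>

lemma G_sums:
  assumes d: "d > 0" "AE x in M. d \<le> \<bar>x - z\<bar>" and h: "\<bar>h\<bar> < d"
  shows "(\<lambda>n. mom n z * h ^ n) sums G (z + h)"
proof -
  have *: "AE x in M. \<bar>1 / (x - z)\<bar> \<le> 1 / d"
    using d(2)
  proof eventually_elim
    case (elim x)
    then show ?case using d(1) by (auto simp: abs_divide intro!: divide_left_mono)
  qed
  have "(\<lambda>n. (\<integral>x. 1 / (x - z) * (1 / (x - z)) ^ n \<partial>M) * h ^ n) sums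
      (\<integral>x. 1 / (x - z) / (1 - h * (1 / (x - z))) \<partial>M)"
    by (rule integral_geometric_sums[OF _ _ * *]) (use h d in auto)
  also have "(\<integral>x. 1 / (x - z) / (1 - h * (1 / (x - z))) \<partial>M) = G (z + h)"
    unfolding Stieltjes_def
  proof (rule integral_cong_AE)
    show "AE x in M. 1 / (x - z) / (1 - h * (1 / (x - z))) = 1 / (x - (z + h))"
      using d(2) by eventually_elim (use d h in \<open>auto simp: field_simps\<close>)
  qed measurable
  finally show ?thesis by (simp add: mom_def)
qed

definition Gfps :: "real \<Rightarrow> real fps" where
  "Gfps z = Abs_fps (\<lambda>n. mom n z)"

lemma fps_nth_Gfps [simp]: "fps_nth (Gfps z) n = mom n z"
  by (simp add: Gfps_def)

lemma G_has_fps_expansion: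
  assumes "z \<notin> {lo..hi}"
  shows "(\<lambda>h. G (z + h)) has_fps_expansion Gfps z"
proof (rule has_fps_expansionI)
  obtain d where d: "d > 0" "AE x in M. d \<le> \<bar>x - z\<bar>" using AE_dist[OF assms] .
  have "eventually (\<lambda>h. h \<in> ball 0 d) (nhds (0::real))"
    using d(1) by (intro eventually_nhds_in_open) auto
  then show "eventually (\<lambda>h. (\<lambda>n. fps_nth (Gfps z) n * h ^ n) sums G (z + h)) (nhds 0)"
    by eventually_elim (use G_sums[OF d] in auto)
qed

lemma mom_0: "mom 0 z = G z"
  by (simp add: mom_def Stieltjes_def)

lemma AE_pos_lower: "z < lo \<Longrightarrow> AE x in M. 0 < 1 / (x - z)"
  using AE_bounds by (auto elim: eventually_mono)

lemma integral_pos_of_AE_pos: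
  assumes "integrable M f" "AE x in M. 0 < (f x :: real)"
  shows "0 < integral\<^sup>L M f"
proof -
  have "0 \<le> integral\<^sup>L M f" using assms(2) by (intro integral_nonneg_AE) (auto elim: eventually_mono)
  moreover have "integral\<^sup>L M f \<noteq> 0"
  proof
    assume "integral\<^sup>L M f = 0"
    then have "AE x in M. f x = 0"
      using assms by (subst (asm) integral_nonneg_eq_0_iff_AE) (auto elim: eventually_mono)
    with assms(2) have "AE x in M. False" by eventually_elim simp
    then show False by simp
  qed
  ultimately show ?thesis by simp
qed

lemma mom_pos: "z < lo \<Longrightarrow> 0 < mom n z"
  unfolding mom_def using AE_pos_lower[of z]
  by (intro integral_pos_of_AE_pos integrable_mom) (auto elim: eventually_mono)

lemma G_pos: "z < lo \<Longrightarrow> 0 < G z"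
  using mom_pos[of z 0] by (simp add: mom_0)

lemma G_neg:
  assumes "hi < z" shows "G z < 0"
proof -
  have "AE x in M. 0 < - ((1 / (x - z)) ^ 1)"
    using AE_bounds by eventually_elim (use assms in \<open>auto simp: divide_less_0_iff\<close>)
  then have "0 < (\<integral>x. - ((1 / (x - z)) ^ 1) \<partial>M)"
    using assms by (intro integral_pos_of_AE_pos integrable_minus integrable_mom) auto
  then show ?thesis by (simp add: Stieltjes_def)
qed

lemma mom_1_pos:
  assumes "z \<notin> {lo..hi}" shows "0 < mom 1 z"
  unfolding mom_def
proof (intro integral_pos_of_AE_pos integrable_mom assms)
  show "AE x in M. 0 < (1 / (x - z)) ^ Suc 1"
    using AE_bounds by eventually_elim (use assms in \<open>auto simp: zero_less_mult_iff\<close>)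
qed

lemma DERIV_G:
  assumes "z \<notin> {lo..hi}" shows "(G has_real_derivative mom 1 z) (at z)"
  using has_fps_expansion_imp_has_real_derivative[OF G_has_fps_expansion[OF assms]] by simp

lemma G_strict_mono_lower: "x < y \<Longrightarrow> y < lo \<Longrightarrow> G x < G y"
  using DERIV_G mom_1_pos by (intro DERIV_pos_imp_increasing[of x y G]) force+

lemma G_strict_mono_upper: "hi < x \<Longrightarrow> x < y \<Longrightarrow> G x < G y"
  using DERIV_G mom_1_pos by (intro DERIV_pos_imp_increasing[of x y G]) force+

text \<open>\<open>G\<close> increases on each side of the support and is positive on the left,
  negative on the right; hence \<open>the_inv_into\<close> in \<open>Stieltjes_inv\<close> is a
  genuine inverse.\<close>

lemma inj_on_G: "inj_on G (- {lo..hi})"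
proof (rule linorder_inj_onI')
  fix x y assume *: "x \<in> - {lo..hi}" "y \<in> - {lo..hi}" "x < y"
  consider "y < lo" | "x > hi" | "x < lo" "y > hi" using * lo_le_hi by fastforce
  then show "G x \<noteq> G y"
    by cases (use G_strict_mono_lower[of x y] G_strict_mono_upper[of x y] G_pos[of x] G_neg[of y] * in auto)
qed

lemma Stieltjes_inv_G: "z \<notin> {lo..hi} \<Longrightarrow> Stieltjes_inv M (G z) = z"
  unfolding Stieltjes_inv_def by (intro the_inv_into_f_f inj_on_G) auto

lemma integral_square_diff:
  fixes X :: "real \<Rightarrow> real"
  assumes "integrable M X" "integrable M (\<lambda>x. (X x)\<^sup>2)"
  shows "(\<integral>x. (X x - t)\<^sup>2 \<partial>M) = (\<integral>x. (X x)\<^sup>2 \<partial>M) - 2 * t * (\<integral>x. X x \<partial>M) + t\<^sup>2"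
proof -
  have "(\<integral>x. (X x - t)\<^sup>2 \<partial>M) = (\<integral>x. (X x)\<^sup>2 - 2 * t * X x + t\<^sup>2 \<partial>M)"
    by (intro Bochner_Integration.integral_cong) (auto simp: power2_eq_square algebra_simps)
  also have "\<dots> = (\<integral>x. (X x)\<^sup>2 \<partial>M) - 2 * t * (\<integral>x. X x \<partial>M) + t\<^sup>2"
    using assms by simp
  finally show ?thesis .
qed

lemma integrable_square_diff:
  fixes X :: "real \<Rightarrow> real"
  assumes "integrable M X" "integrable M (\<lambda>x. (X x)\<^sup>2)"
  shows "integrable M (\<lambda>x. (X x - t)\<^sup>2)"
proof -
  have "integrable M (\<lambda>x. (X x)\<^sup>2 - 2 * t * X x + t\<^sup>2)" using assms by simp
  also have "(\<lambda>x. (X x)\<^sup>2 - 2 * t * X x + t\<^sup>2) = (\<lambda>x. (X x - t)\<^sup>2)"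
    by (auto simp: power2_eq_square algebra_simps)
  finally show ?thesis .
qed

text \<open>The difference of the two sides is the variance of the resolvent
  \<open>1 / (x - z)\<close>.\<close>

lemma mom_0_squared_le: "z \<notin> {lo..hi} \<Longrightarrow> (mom 0 z)\<^sup>2 \<le> mom 1 z"
  and variance_form: "z \<notin> {lo..hi} \<Longrightarrow> (\<integral>x. (1 / (x - z) - G z)\<^sup>2 \<partial>M) = mom 1 z - (G z)\<^sup>2"
proof -
  assume z: "z \<notin> {lo..hi}"
  have "(\<integral>x. (1 / (x - z) - G z)\<^sup>2 \<partial>M) =
      (\<integral>x. (1 / (x - z))\<^sup>2 \<partial>M) - 2 * G z * (\<integral>x. 1 / (x - z) \<partial>M) + (G z)\<^sup>2"
    using integrable_mom[OF z, of 1] integrable_mom[OF z, of 2]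
    by (intro integral_square_diff) simp_all
  then show eq: "(\<integral>x. (1 / (x - z) - G z)\<^sup>2 \<partial>M) = mom 1 z - (G z)\<^sup>2"
    by (simp add: mom_def Stieltjes_def power2_eq_square)
  have "0 \<le> (\<integral>x. (1 / (x - z) - G z)\<^sup>2 \<partial>M)" by (rule integral_nonneg_AE) auto
  with eq show "(mom 0 z)\<^sup>2 \<le> mom 1 z" by (simp add: mom_0)
qed

text \<open>Cauchy-Schwarz for the weight \<open>X ^ Suc n\<close>, obtained by integrating a
  nonnegative quadratic in \<open>t\<close>.\<close>

lemma mom_log_convex:
  assumes "z < lo"
  shows "(mom (Suc n) z)\<^sup>2 \<le> mom n z * mom (Suc (Suc n)) z"
proof -
  have z: "z \<notin> {lo..hi}" using assms by auto
  \<comment> \<open>The minimizer of the quadratic.\<close>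
  define t where "t = mom (Suc n) z / mom n z"
  let ?X = "\<lambda>x. 1 / (x - z)"
  have "0 \<le> (\<integral>x. ?X x ^ Suc n * (?X x - t)\<^sup>2 \<partial>M)"
    using AE_pos_lower[OF assms] by (intro integral_nonneg_AE) (auto elim!: eventually_mono)
  also have "\<dots> = (\<integral>x. ?X x ^ Suc (Suc (Suc n)) - 2 * t * ?X x ^ Suc (Suc n) + t\<^sup>2 * ?X x ^ Suc n \<partial>M)"
    by (intro Bochner_Integration.integral_cong) (auto simp: power2_eq_square algebra_simps)
  also have "\<dots> = mom (Suc (Suc n)) z - 2 * t * mom (Suc n) z + t\<^sup>2 * mom n z"
    unfolding mom_def using integrable_mom[OF z] by (simp del: power_Suc)
  finally show ?thesis
    using mom_pos[OF assms, of n] by (simp add: t_def field_simps power2_eq_square)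
qed

text \<open>Zero variance makes the resolvent, and with it \<open>x\<close>, almost surely constant,
  so the law would be a point mass. This strictness is the source of the uniqueness of the
  minimizer.\<close>

lemma mom_1_strict:
  assumes "non_degenerate M" "z \<notin> {lo..hi}"
  shows "(G z)\<^sup>2 < mom 1 z"
proof (rule ccontr)
  assume "\<not> ?thesis"
  with variance_form[OF assms(2)] mom_0_squared_le[OF assms(2)]
  have "(\<integral>x. (1 / (x - z) - G z)\<^sup>2 \<partial>M) = 0" by (simp add: mom_0)
  moreover have "integrable M (\<lambda>x. (1 / (x - z) - G z)\<^sup>2)"
    using integrable_mom[OF assms(2), of 1] integrable_mom[OF assms(2), of 2]
    by (intro integrable_square_diff) simp_all
  ultimately have "AE x in M. (1 / (x - z) - G z)\<^sup>2 = 0"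
    by (subst (asm) integral_nonneg_eq_0_iff_AE) auto
  with AE_bounds have *: "AE x in M. x = z + 1 / G z"
  proof eventually_elim
    case (elim x)
    then have "1 / (x - z) = G z" by simp
    \<comment> \<open>Double reciprocals cancel even at 0, since \<open>1 / 0 = 0\<close>, so no
      case distinction arises.\<close>
    then have "1 / G z = x - z" by (metis divide_divide_eq_right div_by_1 mult_1)
    then show ?case by simp
  qed
  have "M = return borel (z + 1 / G z)"
  proof (rule measure_eqI)
    fix A assume "A \<in> sets M"
    then have A [measurable]: "A \<in> sets borel" by simp
    show "emeasure M A = emeasure (return borel (z + 1 / G z)) A"
    proof (cases "z + 1 / G z \<in> A")
      case True
      have "emeasure M A = emeasure M (space M)"
        by (rule emeasure_eq_AE) (use * True in \<open>auto elim!: eventually_mono\<close>)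
      then show ?thesis using True emeasure_space_1 by simp
    next
      case False
      have "emeasure M A = emeasure M {}"
        by (rule emeasure_eq_AE) (use * False in \<open>auto elim!: eventually_mono\<close>)
      then show ?thesis using False by simp
    qed
  qed simp
  with assms(1) show False by (auto simp: non_degenerate_def)
qed

section \<open>The R-transform\<close>

abbreviation "K \<equiv> Stieltjes_inv M"

section \<open>Endpoint values and the range of the Stieltjes transform\<close>

text \<open>Monotonicity turns the one-sided limit into a supremum, so that lying below it means
  being exceeded by some value of \<open>G\<close>.\<close>

lemma Stieltjes_minus_eq: "Stieltjes_minus M = (SUP z\<in>{..<lo}. ereal (G z))"
  unfolding Stieltjes_minus_def
proof (rule tendsto_Lim)
  show "((\<lambda>z. ereal (G z)) \<longlongrightarrow> (SUP z\<in>{..<lo}. ereal (G z))) (at_left lo)"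
  proof (rule order_tendstoI)
    fix y assume "y < (SUP z\<in>{..<lo}. ereal (G z))"
    then obtain z0 where z0: "z0 < lo" "y < ereal (G z0)" by (auto simp: less_SUP_iff)
    have "eventually (\<lambda>z. z \<in> {z0<..<lo}) (at_left lo)"
      using z0(1) by (rule eventually_at_left_real)
    then show "eventually (\<lambda>z. y < ereal (G z)) (at_left lo)"
    proof eventually_elim
      case (elim z)
      then have "G z0 < G z" by (intro G_strict_mono_lower) auto
      with z0(2) show ?case by (meson ereal_less(2) less_ereal.simps(1) less_trans)
    qed
  next
    fix y assume y: "(SUP z\<in>{..<lo}. ereal (G z)) < y"
    have "eventually (\<lambda>z. z \<in> {lo - 1<..<lo}) (at_left lo)"
      by (rule eventually_at_left_real) simp
    then show "eventually (\<lambda>z. ereal (G z) < y) (at_left lo)"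
      proof eventually_elim
      case (elim z)
      then have "ereal (G z) \<le> (SUP z\<in>{..<lo}. ereal (G z))" by (intro SUP_upper) auto
      then show ?case using y by (rule le_less_trans)
    qed
  qed
qed simp

lemma Stieltjes_plus_eq: "Stieltjes_plus M = (INF z\<in>{hi<..}. ereal (G z))"
  unfolding Stieltjes_plus_def
proof (rule tendsto_Lim)
  show "((\<lambda>z. ereal (G z)) \<longlongrightarrow> (INF z\<in>{hi<..}. ereal (G z))) (at_right hi)"
  proof (rule order_tendstoI)
    fix y assume "(INF z\<in>{hi<..}. ereal (G z)) < y"
    then obtain z0 where z0: "hi < z0" "ereal (G z0) < y" by (auto simp: INF_less_iff)
    have "eventually (\<lambda>z. z \<in> {hi<..<z0}) (at_right hi)"
      using z0(1) by (rule eventually_at_right_real)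
    then show "eventually (\<lambda>z. ereal (G z) < y) (at_right hi)"
    proof eventually_elim
      case (elim z)
      then have "G z < G z0" by (intro G_strict_mono_upper) auto
      with z0(2) show ?case by (meson ereal_less(2) less_ereal.simps(1) less_trans)
    qed
  next
    fix y assume y: "y < (INF z\<in>{hi<..}. ereal (G z))"
    have "eventually (\<lambda>z. z \<in> {hi<..<hi+1}) (at_right hi)"
      by (rule eventually_at_right_real) simp
    then show "eventually (\<lambda>z. y < ereal (G z)) (at_right hi)"
      proof eventually_elim
      case (elim z)
      then have "(INF z\<in>{hi<..}. ereal (G z)) \<le> ereal (G z)" by (intro INF_lower) auto
      with y show ?case by (rule less_le_trans)
    qed
  qed
qed simp

lemma less_Stieltjes_minus_iff: "ereal y < Stieltjes_minus M \<longleftrightarrow> (\<exists>z<lo. y < G z)"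
  by (auto simp: Stieltjes_minus_eq less_SUP_iff)

lemma Stieltjes_plus_less_iff: "Stieltjes_plus M < ereal y \<longleftrightarrow> (\<exists>z>hi. G z < y)"
  by (auto simp: Stieltjes_plus_eq INF_less_iff)

lemma G_less_Stieltjes_minus:
  assumes "z < lo" shows "ereal (G z) < Stieltjes_minus M"
proof -
  have "z < (z + lo) / 2" "(z + lo) / 2 < lo" using assms by auto
  then show ?thesis
    unfolding less_Stieltjes_minus_iff using G_strict_mono_lower by blast
qed

lemma integrable_resolvent: "z \<notin> {lo..hi} \<Longrightarrow> integrable M (\<lambda>x. 1 / (x - z))"
  using integrable_mom[of z 1] by simp

lemma G_upper_bound:
  assumes "z < lo" shows "G z \<le> 1 / (lo - z)"
proof -
  have "AE x in M. 1 / (x - z) \<le> 1 / (lo - z)"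
    using AE_bounds by eventually_elim (use assms in \<open>auto intro!: divide_left_mono\<close>)
  then have "(\<integral>x. 1 / (x - z) \<partial>M) \<le> (\<integral>x. 1 / (lo - z) \<partial>M)"
    using assms by (intro integral_mono_AE integrable_resolvent) auto
  then show ?thesis by (simp add: Stieltjes_def)
qed

lemma G_lower_bound:
  assumes "hi < z" shows "- (1 / (z - hi)) \<le> G z"
proof -
  have "AE x in M. - (1 / (z - hi)) \<le> 1 / (x - z)"
    using AE_bounds
  proof eventually_elim
    case (elim x)
    then have "1 / (z - x) \<le> 1 / (z - hi)" using assms by (intro divide_left_mono) auto
    then show ?case by (metis minus_diff_eq minus_divide_right neg_le_iff_le)
  qed
  then have "(\<integral>x. - (1 / (z - hi)) \<partial>M) \<le> (\<integral>x. 1 / (x - z) \<partial>M)"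
    using assms by (intro integral_mono_AE integrable_resolvent) auto
  then show ?thesis by (simp add: Stieltjes_def)
qed

lemma exists_G_small:
  assumes "e > 0" obtains z where "z < lo" "G z < e"
proof
  \<comment> \<open>At distance \<open>2 / e\<close> from the support the upper bound for
    \<open>G\<close> is \<open>e / 2\<close>.\<close>
  show "lo - 2 / e < lo" using assms by simp
  then show "G (lo - 2 / e) < e"
    using G_upper_bound[of "lo - 2 / e"] assms by (simp add: field_simps)
qed

lemma exists_G_small_neg:
  assumes "e < 0" obtains z where "hi < z" "e < G z"
proof
  show "hi < hi - 2 / e" using assms by simp
  then show "e < G (hi - 2 / e)"
    using G_lower_bound[of "hi - 2 / e"] assms by (simp add: field_simps)
qed

lemma isCont_G: "z \<notin> {lo..hi} \<Longrightarrow> isCont G z"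
  using DERIV_G DERIV_isCont by blast

lemma G_surj_lower:
  assumes "0 < g" "ereal g < Stieltjes_minus M"
  obtains z where "z < lo" "G z = g"
proof -
  obtain z1 where z1: "z1 < lo" "G z1 < g" using exists_G_small[OF assms(1)] .
  obtain z2 where z2: "z2 < lo" "g < G z2" using assms(2) by (auto simp: less_Stieltjes_minus_iff)
  have "z1 < z2" using z1 z2 G_strict_mono_lower[of z2 z1] by (cases z1 z2 rule: linorder_cases) auto
  then have "\<exists>z\<ge>z1. z \<le> z2 \<and> G z = g"
    using z1 z2 by (intro IVT) (auto intro: isCont_G)
  then obtain z where "z1 \<le> z" "z \<le> z2" "G z = g" by blast
  then show ?thesis using z2 by (intro that[of z]) auto
qed

lemma G_surj_upper:
  assumes "g < 0" "Stieltjes_plus M < ereal g"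
  obtains z where "hi < z" "G z = g"
proof -
  obtain z1 where z1: "hi < z1" "g < G z1" using exists_G_small_neg[OF assms(1)] .
  obtain z2 where z2: "hi < z2" "G z2 < g" using assms(2) by (auto simp: Stieltjes_plus_less_iff)
  have "z2 < z1" using z1 z2 G_strict_mono_upper[of z1 z2] by (cases z1 z2 rule: linorder_cases) auto
  then have "\<exists>z\<ge>z2. z \<le> z1 \<and> G z = g"
    using z1 z2 by (intro IVT) (auto intro: isCont_G)
  then obtain z where "z2 \<le> z" "z \<le> z1" "G z = g" by blast
  then show ?thesis using z2 by (intro that[of z]) auto
qed

lemma
  assumes "0 < g" "ereal g < Stieltjes_minus M"
  shows K_less_lo: "K g < lo" and G_K: "G (K g) = g"
proof -
  obtain z where z: "z < lo" "G z = g" using G_surj_lower[OF assms] .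
  with Stieltjes_inv_G[of z] show "K g < lo" "G (K g) = g" by auto
qed

lemma eventually_K_G:
  assumes "z \<notin> {lo..hi}"
  shows "eventually (\<lambda>y. K (G y) = y) (nhds z)"
proof -
  have "eventually (\<lambda>y. y \<in> - {lo..hi}) (nhds z)"
    using assms by (intro eventually_nhds_in_open) auto
  then show ?thesis by eventually_elim (auto intro: Stieltjes_inv_G)
qed

lemma K_has_fps_expansion:
  assumes "z \<notin> {lo..hi}"
  shows "(\<lambda>h. K (G z + h) - z) has_fps_expansion fps_inv (Gfps z - fps_const (G z))"
proof (rule real_analytic_at_inverse_fun[OF G_has_fps_expansion[OF assms] _ eventually_K_G[OF assms]])
  show "fps_nth (Gfps z) 1 \<noteq> 0" using mom_1_pos[OF assms] by simp
qed

lemma real_analytic_at_K: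
  assumes "z \<notin> {lo..hi}" shows "real_analytic_at K (G z)"
proof -
  have "(\<lambda>h. K (G z + h) - z + z) has_fps_expansion
      fps_inv (Gfps z - fps_const (G z)) + fps_const z"
    by (intro has_fps_expansion_add K_has_fps_expansion assms has_fps_expansion_const)
  then show ?thesis by (intro real_analytic_atI) simp
qed

section \<open>Analyticity of the R-transform on its initial domain\<close>

lemma Dhat_iff: "t \<in> Dhat M \<longleftrightarrow> ereal (- t) < Stieltjes_minus M \<and> Stieltjes_plus M < ereal (- t)"
  unfolding Dhat_def mem_Collect_eq
  by (subst ereal_uminus_less_reorder, subst ereal_less_uminus_reorder) simp

lemma Stieltjes_minus_pos: "0 < Stieltjes_minus M"
proof -
  have "ereal 0 < Stieltjes_minus M"
    unfolding less_Stieltjes_minus_iff using G_pos[of "lo - 1"] by (intro exI[of _ "lo - 1"]) auto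
  then show ?thesis by (simp add: zero_ereal_def)
qed

lemma Stieltjes_plus_neg: "Stieltjes_plus M < 0"
proof -
  have "Stieltjes_plus M < ereal 0"
    unfolding Stieltjes_plus_less_iff using G_neg[of "hi + 1"] by (intro exI[of _ "hi + 1"]) auto
  then show ?thesis by (simp add: zero_ereal_def)
qed

lemma zero_in_Dhat: "0 \<in> Dhat M"
  using Stieltjes_minus_pos Stieltjes_plus_neg by (simp add: Dhat_iff zero_ereal_def)

lemma open_Dhat: "open (Dhat M)"
  unfolding Dhat_def by (intro open_Collect_conj open_Collect_less continuous_on_const continuous_on_ereal continuous_on_id)

lemma is_interval_Dhat: "is_interval (Dhat M)"
  unfolding is_interval_1
proof (intro ballI allI impI)
  fix a b x assume ab: "a \<in> Dhat M" "b \<in> Dhat M" and "a \<le> x \<and> x \<le> b"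
  then have "ereal a \<le> ereal x" "ereal x \<le> ereal b" by auto
  with ab show "x \<in> Dhat M" unfolding Dhat_def mem_Collect_eq by (meson less_le_trans le_less_trans)
qed

lemma minus_in_Dhat_iff:
  assumes "0 < g" shows "- g \<in> Dhat M \<longleftrightarrow> ereal g < Stieltjes_minus M"
proof -
  have "ereal g > 0" using assms by simp
  then have "Stieltjes_plus M < ereal g" using Stieltjes_plus_neg by (rule less_trans[rotated])
  then show ?thesis by (simp add: Dhat_iff)
qed

lemma Dhat_imp_range:
  assumes "t \<in> Dhat M" "t \<noteq> 0"
  obtains z where "z \<notin> {lo..hi}" "G z = - t"
proof (cases "t < 0")
  case True
  with assms obtain z where "z < lo" "G z = - t"
    using G_surj_lower[of "-t"] by (auto simp: Dhat_iff)
  then show ?thesis by (intro that) auto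
next
  case False
  with assms obtain z where "hi < z" "G z = - t"
    using G_surj_upper[of "-t"] by (auto simp: Dhat_iff)
  then show ?thesis by (intro that) auto
qed

lemma real_analytic_at_Rhat:
  assumes "t \<in> Dhat M" "t \<noteq> 0"
  shows "real_analytic_at (Rhat M) t"
proof -
  obtain z where z: "z \<notin> {lo..hi}" "G z = - t" using Dhat_imp_range[OF assms] .
  have "real_analytic_at (\<lambda>t. K (- t) - inverse t) t"
  proof (intro real_analytic_at_diff real_analytic_at_inverse real_analytic_at_ident)
    show "real_analytic_at (\<lambda>t. K (- t)) t"
      using real_analytic_at_K[OF z(1)] z(2) by (intro real_analytic_at_reflect) simp
  qed fact
  then show ?thesis unfolding Rhat_def[abs_def] by (simp add: divide_inverse)
qed

lemma real_analytic_at_Rhat_0: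
  obtains c where "real_analytic_at (\<lambda>t. if t = 0 then c else Rhat M t) 0"
proof -
  \<comment> \<open>In the coordinate \<open>u = -1/z\<close> at infinity, \<open>G\<close> becomes the function \<open>g\<close> below with
    \<open>g'(0) = 1\<close>, so that \<open>-1/K\<close> extends analytically to \<open>0\<close> as the local inverse \<open>k\<close> of \<open>g\<close>.\<close>
  define C where "C = max \<bar>lo\<bar> \<bar>hi\<bar> + 1"
  have C: "C > 0" by (simp add: C_def)
  define g where "g u = u * (\<integral>x. 1 / (1 - u * (- x)) \<partial>M)" for u
  define F where "F = fps_X * Abs_fps (\<lambda>n. \<integral>x. 1 * (- x) ^ n \<partial>M)"
  have ev: "eventually (\<lambda>u. \<bar>u\<bar> * C < 1) (nhds 0)"
  proof -
    have "eventually (\<lambda>u. u \<in> ball 0 (1 / C)) (nhds (0::real))"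
      using C by (intro eventually_nhds_in_open) auto
    then show ?thesis by eventually_elim (use C in \<open>auto simp: field_simps\<close>)
  qed
  have F: "(\<lambda>h. g (0 + h)) has_fps_expansion F"
    unfolding g_def F_def
  proof (simp only: add_0, intro has_fps_expansion_mult has_fps_expansion_fps_X has_fps_expansionI)
    show "eventually (\<lambda>u. (\<lambda>n. fps_nth (Abs_fps (\<lambda>n. \<integral>x. 1 * (- x) ^ n \<partial>M)) n * u ^ n) sums
        (\<integral>x. 1 / (1 - u * (- x)) \<partial>M)) (nhds 0)"
      using ev
    proof eventually_elim
      case (elim u)
      have "AE x in M. \<bar>- x\<bar> \<le> C"
        using AE_bounds by eventually_elim (auto simp: C_def)
      then have "(\<lambda>n. (\<integral>x. 1 * (- x) ^ n \<partial>M) * u ^ n) sums (\<integral>x. 1 / (1 - u * (- x)) \<partial>M)"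
        by (intro integral_geometric_sums[where C = 1 and Q = C]) (use elim in auto)
      then show ?case by simp
    qed
  qed
  have F1: "fps_nth F 1 = 1" by (simp add: F_def)
  have g0: "g 0 = 0" by (simp add: g_def)
  define k where "k y = (if y = 0 then 0 else - 1 / K y)" for y
  have k: "eventually (\<lambda>u. k (g u) = u) (nhds 0)"
    using ev
  proof eventually_elim
    case (elim u)
    show ?case
    proof (cases "u = 0")
      case False
      have "\<bar>- 1 / u\<bar> > C" using elim False by (auto simp: field_simps)
      then have z: "- 1 / u \<notin> {lo..hi}" by (auto simp: C_def)
      have "G (- 1 / u) = g u"
        unfolding g_def Stieltjes_def integral_mult_right_zero[symmetric]
      proof (rule Bochner_Integration.integral_cong[OF refl])
        fix x show "1 / (x - - 1 / u) = u * (1 / (1 - u * - x))"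
          using False by (cases "1 + u * x = 0") (auto simp: field_simps)
      qed
      moreover have "G (- 1 / u) \<noteq> 0"
        using z G_pos[of "-1/u"] G_neg[of "-1/u"] by force
      ultimately show ?thesis using Stieltjes_inv_G[OF z] by (simp add: k_def)
    qed (simp add: k_def g0)
  qed
  define Fi where "Fi = fps_inv F"
  have Fi: "k has_fps_expansion Fi"
    using real_analytic_at_inverse_fun[OF F _ k] F1 g0 by (simp add: Fi_def)
  have Fi0: "fps_nth Fi 0 = 0" by (simp add: Fi_def fps_inv_def)
  have Fi1: "fps_nth Fi 1 = 1" using F1 by (simp add: Fi_def fps_inv_def)
  \<comment> \<open>Since \<open>k\<close> has expansion \<open>y + ...\<close>, it factors as
    \<open>k y = y * p y\<close> with \<open>p 0 = 1\<close>.\<close>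
  define p where "p y = (if y = 0 then 1 else k y / y ^ 1)" for y
  have "1 \<le> subdegree Fi"
    using Fi0 Fi1 by (intro subdegree_geI) (auto simp: fps_nonzero_nth intro!: exI[of _ "Suc 0"])
  then have P: "p has_fps_expansion fps_shift 1 Fi"
    unfolding p_def[abs_def] using Fi Fi1 by (intro has_fps_expansion_shift) auto
  define Q where "Q = fps_shift 1 Fi - 1"
  have Q: "(\<lambda>y. p y - 1) has_fps_expansion Q"
    unfolding Q_def using P by (intro has_fps_expansion_diff) auto
  have Q0: "fps_nth Q 0 = 0" using Fi1 by (simp add: Q_def)
  \<comment> \<open>Writing \<open>p y = 1 + y * r y\<close> cancels the pole:
    \<open>1 / (t * p (- t)) - 1 / t = r (- t) / p (- t)\<close>, analytic at 0 with value
    \<open>r 0\<close>.\<close>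
  define r where "r y = (if y = 0 then fps_nth Q 1 else (p y - 1) / y ^ 1)" for y
  have "r has_fps_expansion fps_shift 1 Q"
  \<comment> \<open>Because \<open>subdegree 0 = 0\<close>, the shift rule misses the zero series;
    in that case \<open>Rhat\<close> vanishes near 0.\<close>
  proof (cases "Q = 0")
    case True
    then have "eventually (\<lambda>y. p y - 1 = 0) (nhds 0)" using Q by (simp add: has_fps_expansion_0_iff)
    then have "eventually (\<lambda>y. r y = 0) (nhds 0)"
      by eventually_elim (auto simp: r_def True)
    then show ?thesis using True by (simp add: has_fps_expansion_0_iff)
  next
    case False
    then have "1 \<le> subdegree Q"
      using Q0 by (intro subdegree_geI) auto
    then show ?thesis
      unfolding r_def[abs_def] using Q by (intro has_fps_expansion_shift) auto
  qed
  then have r: "real_analytic_at r 0" by (intro real_analytic_atI) simp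
  have p: "real_analytic_at p 0" using P by (intro real_analytic_atI) simp
  have p0: "p 0 = 1" by (simp add: p_def)
  obtain R1 where R1: "(\<lambda>h. r h) has_fps_expansion R1" using r by (auto elim: real_analytic_atE)
  obtain P1 where P1: "(\<lambda>h. p h) has_fps_expansion P1" using p by (auto elim: real_analytic_atE)
  have P10: "fps_nth P1 0 \<noteq> 0" using has_fps_expansion_nth_0[OF P1] p0 by simp
  have "real_analytic_at (\<lambda>y. r y / p y) 0"
    using has_fps_expansion_divide'[OF R1 P1 P10] by (intro real_analytic_atI) simp
  then have rp: "real_analytic_at (\<lambda>t. r (- t) / p (- t)) 0"
    using real_analytic_at_reflect[of "\<lambda>y. r y / p y" 0] by simp
  have "real_analytic_at (\<lambda>t. p (- t)) 0"
    using p real_analytic_at_reflect[of p 0] by simp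
  then have "isCont (\<lambda>t. p (- t)) 0" by (rule real_analytic_at_imp_isCont)
  from isCont_imp_filterlim_nhds[OF this]
  have "eventually (\<lambda>t. p (- t) \<noteq> 0) (nhds 0)"
    using tendsto_imp_eventually_ne p0 by fastforce
  then have "eventually (\<lambda>t. r (- t) / p (- t) = (if t = 0 then r 0 else Rhat M t)) (nhds 0)"
  proof eventually_elim
    case (elim t)
    show ?case
    proof (cases "t = 0")
      case False
      have "K (- t) = - 1 / k (- t)" using False by (simp add: k_def)
      also have "k (- t) = - t * p (- t)" using False by (simp add: p_def)
      finally have "Rhat M t = 1 / (t * p (- t)) - 1 / t" by (simp add: Rhat_def)
      also have "\<dots> = r (- t) / p (- t)"
        using False elim by (simp add: r_def field_simps)
      finally show ?thesis using False by simp
    qed (use p0 in simp)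
  qed
  from real_analytic_at_cong[OF rp this] show ?thesis by (rule that)
qed

text \<open>Filling in the value at 0 gives an extension on \<open>Dhat M\<close> itself, which is
  all that the gluing argument requires.\<close>

lemma R_extension_R_transform: "R_extension M (R_domain M) (R_transform M)"
proof -
  obtain c where c: "real_analytic_at (\<lambda>t. if t = 0 then c else Rhat M t) 0"
    using real_analytic_at_Rhat_0 .
  have "R_extension M (Dhat M) (\<lambda>t. if t = 0 then c else Rhat M t)"
    unfolding R_extension_def
  proof (intro conjI open_Dhat is_interval_Dhat)
    show "real_analytic_on (\<lambda>t. if t = 0 then c else Rhat M t) (Dhat M)"
    proof (rule real_analytic_on_iff_at[THEN iffD2], rule ballI)
      fix t assume t: "t \<in> Dhat M"
      show "real_analytic_at (\<lambda>t. if t = 0 then c else Rhat M t) t"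
      proof (cases "t = 0")
        case False
        have "eventually (\<lambda>s. s \<in> - {0}) (nhds t)"
          using False by (intro eventually_nhds_in_open) auto
        then have "eventually (\<lambda>s. Rhat M s = (if s = 0 then c else Rhat M s)) (nhds t)"
          by eventually_elim auto
        with real_analytic_at_Rhat[OF t False] show ?thesis by (rule real_analytic_at_cong)
      qed (use c in simp)
    qed
  qed auto
  then show ?thesis by (rule R_extension_R_domain[OF open_Dhat zero_in_Dhat])
qed

lemma Dhat_subset_R_domain: "Dhat M \<subseteq> R_domain M"
  using R_extension_R_transform by (simp add: R_extension_def)

lemma real_analytic_at_R_transform: "t \<in> R_domain M \<Longrightarrow> real_analytic_at (R_transform M) t"
  using R_extension_R_transform by (auto simp: R_extension_def real_analytic_on_def)

lemma R_transform_eq: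
  assumes "0 < g" "ereal g < Stieltjes_minus M"
  shows "R_transform M (- g) = K g + 1 / g"
proof -
  have "- g \<in> Dhat M - {0}" using assms minus_in_Dhat_iff by auto
  then have "R_transform M (- g) = Rhat M (- g)"
    using R_extension_R_transform unfolding R_extension_def by blast
  then show ?thesis by (simp add: Rhat_def)
qed

end

section \<open>Power series of Stieltjes transforms\<close>

lemma fps_inverse_mult_nth:
  fixes F :: "real fps"
  assumes "fps_nth F 0 \<noteq> 0"
  shows "(\<Sum>k=0..n. fps_nth (inverse F) k * fps_nth F (n - k)) = (if n = 0 then 1 else 0)"
proof -
  have "fps_nth (inverse F * F) n = fps_nth 1 n"
    using assms by (simp add: inverse_mult_eq_1)
  then show ?thesis by (simp add: fps_mult_nth)
qed

text \<open>Log-convexity means that the ratios \<open>m (Suc n) / m n\<close> are nondecreasing;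
  here they are compared \<open>k\<close> steps apart, cross-multiplied.\<close>

lemma log_convex_ratio:
  fixes m :: "nat \<Rightarrow> real"
  assumes pos: "\<And>n. m n > 0" and lc: "\<And>n. (m (Suc n))\<^sup>2 \<le> m n * m (Suc (Suc n))"
  shows "m (i + k) * m (Suc i) \<le> m i * m (Suc (i + k))"
proof (induction k)
  case (Suc k)
  have "m (i + k) * (m (Suc (i + k)) * m (Suc i)) = m (Suc (i + k)) * (m (i + k) * m (Suc i))"
    by (simp add: mult_ac)
  also have "\<dots> \<le> m (Suc (i + k)) * (m i * m (Suc (i + k)))"
    using Suc pos[of "Suc (i + k)"] by (intro mult_left_mono) auto
  also have "\<dots> = m i * (m (Suc (i + k)))\<^sup>2"
    by (simp add: power2_eq_square mult_ac)
  also have "\<dots> \<le> m i * (m (i + k) * m (Suc (Suc (i + k))))"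
    using lc[of "i + k"] pos[of i] by (intro mult_left_mono) auto
  also have "\<dots> = m (i + k) * (m i * m (Suc (Suc (i + k))))"
    by (simp add: mult_ac)
  finally show ?case using pos[of "i + k"] by simp
qed (simp add: mult.commute)

text \<open>Weighting the convolution identities for \<open>inverse F * F\<close> at
  \<open>Suc n\<close> and \<open>n\<close> by \<open>m n\<close> and \<open>m (Suc n)\<close> and
  subtracting eliminates \<open>b 0\<close>. The remaining sum is nonnegative by monotone ratios, as
  the \<open>b k\<close> in it are nonpositive by induction, which forces the sign of
  \<open>b (Suc n)\<close>.\<close>

lemma Kaluza_inverse_nonpos:
  fixes F :: "real fps"
  assumes pos: "\<And>n. fps_nth F n > 0"
    and lc: "\<And>n. (fps_nth F (Suc n))\<^sup>2 \<le> fps_nth F n * fps_nth F (Suc (Suc n))"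
  shows "fps_nth (inverse F) (Suc n) \<le> 0"
proof (induction n rule: less_induct)
  case (less n)
  define m where "m = fps_nth F"
  define b where "b = fps_nth (inverse F)"
  have pos: "m n > 0" for n using pos by (simp add: m_def)
  have F0: "fps_nth F 0 \<noteq> 0" using pos[of 0] by (simp add: m_def)
  have S1: "b 0 * m (Suc n) + (\<Sum>k=1..n. b k * m (Suc n - k)) + b (Suc n) * m 0 = 0"
    using fps_inverse_mult_nth[OF F0, of "Suc n"]
    by (simp add: m_def b_def sum.atLeast_Suc_atMost[of 0])
  have S0: "b 0 * m n + (\<Sum>k=1..n. b k * m (n - k)) = (if n = 0 then 1 else 0)"
    using fps_inverse_mult_nth[OF F0, of n]
    by (simp add: m_def b_def sum.atLeast_Suc_atMost[of 0])
  have "m n * (\<Sum>k=1..n. b k * m (Suc n - k)) \<ge> m (Suc n) * (\<Sum>k=1..n. b k * m (n - k))"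
    unfolding sum_distrib_left
  proof (rule sum_mono)
    fix k assume k: "k \<in> {1..n}"
    then have "b k \<le> 0" using less[of "k - 1"] by (cases k) (simp_all add: b_def)
    moreover have "m n * m (Suc n - k) \<le> m (Suc n) * m (n - k)"
      using log_convex_ratio[of m "n - k" k] pos lc k by (simp add: m_def Suc_diff_le mult.commute)
    ultimately have "b k * (m (Suc n) * m (n - k)) \<le> b k * (m n * m (Suc n - k))"
      by (rule mult_left_mono_neg[rotated])
    then show "m (Suc n) * (b k * m (n - k)) \<le> m n * (b k * m (Suc n - k))"
      by (simp add: mult_ac)
  qed
  moreover have "m n * (b 0 * m (Suc n) + (\<Sum>k=1..n. b k * m (Suc n - k)) + b (Suc n) * m 0) = 0"
    using S1 by simp
  moreover have "m (Suc n) * (b 0 * m n + (\<Sum>k=1..n. b k * m (n - k))) \<ge> 0"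
    unfolding S0 using pos[of "Suc n"] by simp
  ultimately have "m n * m 0 * b (Suc n) \<le> 0"
    by (simp add: algebra_simps)
  then show ?case using pos[of n] pos[of 0] by (simp add: b_def mult_le_0_iff)
qed

lemma inverse_coeff_bound:
  fixes F :: "real fps"
  assumes pos: "\<And>n. fps_nth F n \<ge> 0" "fps_nth F 0 > 0"
    and nonpos: "\<And>n. fps_nth (inverse F) (Suc n) \<le> 0"
  shows "- fps_nth (inverse F) (Suc n) \<le> fps_nth F (Suc n) / (fps_nth F 0)\<^sup>2"
proof -
  define m where "m = fps_nth F"
  define b where "b = fps_nth (inverse F)"
  have F0: "fps_nth F 0 \<noteq> 0" using pos(2) by simp
  have "b 0 * m (Suc n) + (\<Sum>k=1..n. b k * m (Suc n - k)) + b (Suc n) * m 0 = 0"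
    using fps_inverse_mult_nth[OF F0, of "Suc n"]
    by (simp add: m_def b_def sum.atLeast_Suc_atMost[of 0])
  moreover have "(\<Sum>k=1..n. b k * m (Suc n - k)) \<le> 0"
  proof (rule sum_nonpos)
    fix k assume "k \<in> {1..n}"
    then have "b k \<le> 0" using nonpos[of "k - 1"] by (cases k) (simp_all add: b_def)
    then show "b k * m (Suc n - k) \<le> 0" using pos(1) by (simp add: m_def mult_nonpos_nonneg)
  qed
  ultimately have "- b (Suc n) * m 0 \<le> b 0 * m (Suc n)" by simp
  moreover have "b 0 = 1 / m 0" by (simp add: b_def m_def inverse_eq_divide)
  ultimately show ?thesis using pos(2) by (simp add: b_def m_def field_simps power2_eq_square)
qed

section \<open>Compositions of series with nonnegative coefficients\<close>

lemma fps_power_nth_nonneg: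
  fixes A :: "real fps"
  assumes "\<And>j. j < n \<Longrightarrow> fps_nth A j \<ge> 0" and "k < n"
  shows "fps_nth (A ^ i) k \<ge> 0"
  using assms(2)
proof (induction i arbitrary: k)
  case (Suc i)
  then show ?case
    using assms(1) by (auto simp: fps_mult_nth intro!: sum_nonneg mult_nonneg_nonneg)
qed simp

text \<open>As \<open>A\<close> has no constant term, coefficient \<open>n\<close> of a power beyond
  the first involves only coefficients of \<open>A\<close> below \<open>n\<close>, those known in an
  induction.\<close>

lemma fps_power_nth_nonneg_top:
  fixes A :: "real fps"
  assumes nn: "\<And>j. j < n \<Longrightarrow> fps_nth A j \<ge> 0" and A0: "fps_nth A 0 = 0" and i: "i \<ge> 2"
  shows "fps_nth (A ^ i) n \<ge> 0"
proof -
  obtain l where l: "i = Suc (Suc l)" using i by (metis Suc_le_D numeral_2_eq_2 Suc_le_mono)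
  have "fps_nth (A ^ i) n = (\<Sum>j=0..n. fps_nth A j * fps_nth (A ^ Suc l) (n - j))"
    unfolding l by (subst power_Suc) (simp only: fps_mult_nth)
  also have "\<dots> \<ge> 0"
  proof (rule sum_nonneg)
    fix j assume j: "j \<in> {0..n}"
    consider "j = 0" | "j = n" | "0 < j" "j < n" using j by force
    then show "fps_nth A j * fps_nth (A ^ Suc l) (n - j) \<ge> 0"
    proof cases
      case 3
      then show ?thesis
        by (intro mult_nonneg_nonneg fps_power_nth_nonneg[where n = n]) (use nn in auto)
    qed (use A0 in simp_all)
  qed
  finally show ?thesis .
qed

text \<open>The still unknown coefficient of \<open>A\<close> enters only through the linear term of
  \<open>P\<close>; the higher powers contribute nonnegative amounts.\<close>

lemma fps_compose_nth_ge:
  fixes P A :: "real fps"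
  assumes P: "\<And>i. i \<ge> 1 \<Longrightarrow> fps_nth P i \<ge> 0"
    and nn: "\<And>j. j < n \<Longrightarrow> fps_nth A j \<ge> 0" and A0: "fps_nth A 0 = 0" and n: "n \<ge> 1"
  shows "fps_nth P 1 * fps_nth A n \<le> fps_nth (P oo A) n"
proof -
  have "fps_nth (P oo A) n = (\<Sum>i=0..n. fps_nth P i * fps_nth (A ^ i) n)"
    by (simp add: fps_compose_nth)
  also have "\<dots> = fps_nth P 0 * fps_nth (A ^ 0) n + (fps_nth P 1 * fps_nth (A ^ 1) n +
      (\<Sum>i=2..n. fps_nth P i * fps_nth (A ^ i) n))"
    using sum.atLeast_Suc_atMost[of 0 n "\<lambda>i. fps_nth P i * fps_nth (A ^ i) n"]
      sum.atLeast_Suc_atMost[of 1 n "\<lambda>i. fps_nth P i * fps_nth (A ^ i) n"] n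
    by (simp only: One_nat_def numeral_2_eq_2 le0)
  finally have eq: "fps_nth (P oo A) n = fps_nth P 0 * fps_nth (A ^ 0) n + (fps_nth P 1 * fps_nth (A ^ 1) n +
      (\<Sum>i=2..n. fps_nth P i * fps_nth (A ^ i) n))" .
  have "(\<Sum>i=2..n. fps_nth P i * fps_nth (A ^ i) n) \<ge> 0"
    using P by (intro sum_nonneg mult_nonneg_nonneg fps_power_nth_nonneg_top nn A0) auto
  with eq n show ?thesis by simp
qed

text \<open>\<open>P\<close> and \<open>Q\<close> stand for \<open>- 1 / G\<close> of the two laws,
  \<open>A\<close> and \<open>B\<close> for the subordination functions. Coefficient
  \<open>n\<close> of the two equations yields \<open>p * A + d \<le> B\<close> and
  \<open>q * B + d \<le> A\<close>; inserting one into the other gives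
  \<open>(1 - p * q) * A \<ge> 0\<close>.\<close>

lemma subordination_coeffs_nonneg:
  fixes P Q A B :: "real fps"
  assumes P: "\<And>i. i \<ge> 1 \<Longrightarrow> fps_nth P i \<ge> 0" "fps_nth P 1 \<ge> 1"
    and Q: "\<And>i. i \<ge> 1 \<Longrightarrow> fps_nth Q i \<ge> 0" "fps_nth Q 1 \<ge> 1"
    and A: "fps_nth A 0 = 0" "fps_nth A 1 > 0" and B: "fps_nth B 0 = 0"
    and PA: "P oo A = A + B - fps_X + fps_const c" and QB: "Q oo B = A + B - fps_X + fps_const c"
  shows "fps_nth A n \<ge> 0 \<and> fps_nth B n \<ge> 0"
proof (induction n rule: less_induct)
  case (less n)
  define p q where "p = fps_nth P 1 - 1" and "q = fps_nth Q 1 - 1"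
  have pq: "p \<ge> 0" "q \<ge> 0" using P Q by (auto simp: p_def q_def)
  \<comment> \<open>The coefficients of \<open>fps_X\<close>.\<close>
  define d :: "nat \<Rightarrow> real" where "d n = (if n = 1 then 1 else 0)" for n
  have step: "p * fps_nth A k + d k \<le> fps_nth B k \<and> q * fps_nth B k + d k \<le> fps_nth A k"
    if "k \<ge> 1" "\<And>j. j < k \<Longrightarrow> fps_nth A j \<ge> 0 \<and> fps_nth B j \<ge> 0" for k
  proof -
    have "fps_nth P 1 * fps_nth A k \<le> fps_nth (P oo A) k"
      using that by (intro fps_compose_nth_ge P A) auto
    moreover have "fps_nth Q 1 * fps_nth B k \<le> fps_nth (Q oo B) k"
      using that by (intro fps_compose_nth_ge Q B) auto
    ultimately show ?thesis
      unfolding PA QB p_def q_def d_def using that(1) by (auto simp: fps_X_def algebra_simps)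
  qed
  \<comment> \<open>At index 1 the inserted inequality is strict,
    \<open>(1 - p * q) * A 1 \<ge> 1 + q\<close>, and \<open>A 1 > 0\<close> fixes the sign for all
    indices.\<close>
  have pq1: "p * q < 1"
  proof -
    have s: "p * fps_nth A 1 + 1 \<le> fps_nth B 1" "q * fps_nth B 1 + 1 \<le> fps_nth A 1"
      using step[of 1] A B by (auto simp: d_def)
    have "q * (p * fps_nth A 1 + 1) \<le> q * fps_nth B 1" using s pq by (intro mult_left_mono) auto
    with s pq have "0 < (1 - p * q) * fps_nth A 1" by (simp add: algebra_simps)
    with A(2) show ?thesis by (simp add: zero_less_mult_iff)
  qed
  show ?case
  proof (cases "n = 0")
    case False
    then have s: "p * fps_nth A n + d n \<le> fps_nth B n" "q * fps_nth B n + d n \<le> fps_nth A n"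
      using step[of n] less by auto
    have d: "d n \<ge> 0" by (simp add: d_def)
    have "q * (p * fps_nth A n + d n) \<le> q * fps_nth B n" using s pq by (intro mult_left_mono) auto
    moreover have "q * d n \<ge> 0" using pq d by simp
    ultimately have "0 \<le> (1 - p * q) * fps_nth A n" using s d by (simp add: algebra_simps)
    with pq1 have "fps_nth A n \<ge> 0" by (simp add: zero_le_mult_iff)
    moreover from this have "p * fps_nth A n \<ge> 0" using pq by simp
    ultimately show ?thesis using s d by linarith
  qed (use A B in simp)
qed

lemma suminf_commute_ennreal:
  fixes f :: "nat \<Rightarrow> nat \<Rightarrow> ennreal"
  shows "(\<Sum>n. \<Sum>k. f n k) = (\<Sum>k. \<Sum>n. f n k)"
  using nn_integral_suminf[of "\<lambda>n k. f n k" "count_space (UNIV :: nat set)"]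
  by (simp add: nn_integral_count_space_nat)

text \<open>Tonelli for the nonnegative array \<open>F n * (A ^ n) k * x ^ k\<close>, summed in
  \<open>ennreal\<close>. Convergence of the series of \<open>F\<close> at
  \<open>eval_fps A x\<close> is a conclusion here; this is what keeps the subordination function
  within reach of the Taylor series of \<open>G\<close>.\<close>

lemma compose_sums_nonneg:
  fixes F A :: "real fps"
  assumes F: "\<And>n. fps_nth F n \<ge> 0" and A: "\<And>n. fps_nth A n \<ge> 0" "fps_nth A 0 = 0"
    and x: "x \<ge> 0" "ereal x < fps_conv_radius A"
    and sm: "(\<lambda>k. fps_nth (F oo A) k * x ^ k) sums s"
  shows "(\<lambda>n. fps_nth F n * eval_fps A x ^ n) sums s"
proof -
  define f where "f n k = fps_nth F n * fps_nth (A ^ n) k * x ^ k" for n k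
  have An: "fps_nth (A ^ n) k \<ge> 0" for n k
    by (rule fps_power_nth_nonneg[of "Suc k"]) (use A in auto)
  have f0: "f n k \<ge> 0" for n k
    unfolding f_def using F An x by simp
  have rows: "(\<lambda>k. f n k) sums (fps_nth F n * eval_fps A x ^ n)" for n
  proof -
    have "ereal (norm x) < fps_conv_radius (A ^ n)"
      using x fps_conv_radius_power[of A n] by (auto intro: less_le_trans)
    then have "(\<lambda>k. fps_nth (A ^ n) k * x ^ k) sums eval_fps (A ^ n) x" by (rule sums_eval_fps)
    also have "eval_fps (A ^ n) x = eval_fps A x ^ n"
      using x by (intro eval_fps_power) auto
    finally show ?thesis unfolding f_def mult.assoc by (rule sums_mult)
  qed
  have cols: "(\<lambda>n. f n k) sums (fps_nth (F oo A) k * x ^ k)" for k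
  proof -
    have "(\<lambda>n. f n k) sums (\<Sum>n\<in>{0..k}. f n k)"
    proof (rule sums_finite)
      fix n assume "n \<notin> {0..k}"
      then have "fps_nth (A ^ n) k = 0" using A(2) by (intro startsby_zero_power_prefix[rule_format]) auto
      then show "f n k = 0" by (simp add: f_def)
    qed simp
    also have "(\<Sum>n\<in>{0..k}. f n k) = fps_nth (F oo A) k * x ^ k"
      by (simp add: f_def fps_compose_nth sum_distrib_right)
    finally show ?thesis .
  qed
  have y0: "eval_fps A x \<ge> 0"
    by (rule sums_le[OF _ sums_zero sums_eval_fps[of x A]]) (use x A in auto)
  have c0: "fps_nth (F oo A) k * x ^ k \<ge> 0" for k
    by (rule sums_le[OF _ sums_zero cols[of k]]) (rule f0)
  have s0: "s \<ge> 0"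
    by (rule sums_le[OF _ sums_zero sm]) (rule c0)
  have row': "(\<Sum>k. ennreal (f n k)) = ennreal (fps_nth F n * eval_fps A x ^ n)" for n
    using rows[of n] f0 by (simp add: suminf_ennreal2 sums_iff)
  have col': "(\<Sum>n. ennreal (f n k)) = ennreal (fps_nth (F oo A) k * x ^ k)" for k
    using cols[of k] f0 by (simp add: suminf_ennreal2 sums_iff)
  have "(\<Sum>n. ennreal (fps_nth F n * eval_fps A x ^ n)) = (\<Sum>k. ennreal (fps_nth (F oo A) k * x ^ k))"
    using suminf_commute_ennreal[of "\<lambda>n k. ennreal (f n k)"] by (simp add: row' col')
  also have "\<dots> = ennreal s"
    using sm c0 by (simp add: suminf_ennreal2 sums_iff)
  finally have "(\<Sum>n. ennreal (fps_nth F n * eval_fps A x ^ n)) = ennreal s" .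
  moreover have "(\<lambda>n. ennreal (fps_nth F n * eval_fps A x ^ n)) sums
      (\<Sum>n. ennreal (fps_nth F n * eval_fps A x ^ n))"
    by (rule summable_sums) (rule summableI)
  ultimately show ?thesis
    using F y0 s0 by (simp add: sums_ennreal)
qed

context compact_law
begin

text \<open>For \<open>y > lo - w\<close> the mass near \<open>lo\<close> keeps the terms away from \<open>0\<close>.\<close>
lemma summable_imp_le_lo:
  assumes w: "w < lo" and y: "summable (\<lambda>n. mom n w * y ^ n)"
  shows "w + y \<le> lo"
proof (rule ccontr)
  assume "\<not> w + y \<le> lo"
  then have y0: "y > lo - w" by simp
  with w have ypos: "y > 0" by simp
  define c where "c = measure M {lo..<w + y}"
  have c: "c > 0" using measure_near_lo_pos[of "w + y - lo"] y0 by (simp add: c_def)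
  have "c / y \<le> mom n w * y ^ n" for n
  proof -
    have "c * (1 / y) ^ Suc n = (\<integral>x. indicator {lo..<w + y} x * (1 / y) ^ Suc n \<partial>M)"
      by (simp add: c_def)
    also have "\<dots> \<le> mom n w"
      unfolding mom_def
    proof (rule integral_mono_AE)
      show "AE x in M. indicator {lo..<w + y} x * (1 / y) ^ Suc n \<le> (1 / (x - w)) ^ Suc n"
        using AE_bounds
      proof eventually_elim
        case (elim x)
        show ?case
        proof (cases "x < w + y")
          case True
          then have "1 / y \<le> 1 / (x - w)" using elim w by (intro divide_left_mono) auto
          then have "(1 / y) ^ Suc n \<le> (1 / (x - w)) ^ Suc n"
            using ypos by (intro power_mono) auto
          with True elim show ?thesis by simp
        qed (use elim w in simp)
      qed
      show "integrable M (\<lambda>x. (1 / (x - w)) ^ Suc n)" using w by (intro integrable_mom) auto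
      show "integrable M (\<lambda>x. indicator {lo..<w + y} x * (1 / y) ^ Suc n)"
        by (intro integrable_mult_left integrable_real_indicator) (auto simp: emeasure_eq_measure)
    qed
    finally have "c * (1 / y) ^ Suc n * y ^ n \<le> mom n w * y ^ n"
      using ypos by (intro mult_right_mono) auto
    also have "c * (1 / y) ^ Suc n * y ^ n = c / y"
      using ypos by (simp add: power_divide)
    finally show ?thesis .
  qed
  then have "c / y \<le> 0"
    using summable_LIMSEQ_zero[OF y] by (intro LIMSEQ_le_const) auto
  with c ypos show False by (simp add: divide_le_0_iff)
qed

lemma Gfps_inverse_nonneg:
  assumes "w < lo" "i \<ge> 1"
  shows "fps_nth (- inverse (Gfps w)) i \<ge> 0"
proof -
  obtain n where i: "i = Suc n" using assms(2) by (metis Suc_le_D One_nat_def)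
  have "fps_nth (inverse (Gfps w)) (Suc n) \<le> 0"
    by (rule Kaluza_inverse_nonpos) (use assms(1) mom_pos mom_log_convex in auto)
  then show ?thesis by (simp add: i)
qed

text \<open>The coefficient is \<open>mom 1 w / (mom 0 w)\<^sup>2\<close>, at least 1 by
  nonnegativity of the variance.\<close>

lemma Gfps_inverse_1:
  assumes "w < lo"
  shows "fps_nth (- inverse (Gfps w)) 1 \<ge> 1"
proof -
  have F0: "fps_nth (Gfps w) 0 \<noteq> 0" using mom_pos[OF assms, of 0] by simp
  have m0: "mom 0 w > 0" using mom_pos[OF assms] .
  have "fps_nth (inverse (Gfps w)) 0 * mom 1 w + fps_nth (inverse (Gfps w)) 1 * mom 0 w = 0"
    using fps_inverse_mult_nth[OF F0, of 1] by simp
  then have "- fps_nth (inverse (Gfps w)) 1 * mom 0 w = mom 1 w / mom 0 w"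
    by (simp add: inverse_eq_divide)
  then have "- fps_nth (inverse (Gfps w)) 1 = mom 1 w / (mom 0 w)\<^sup>2"
    using m0 by (simp add: field_simps power2_eq_square)
  also have "\<dots> \<ge> 1"
    using m0 mom_0_squared_le[of w] assms by simp
  finally show ?thesis by simp
qed

end

section \<open>The range of the Stieltjes transform of a free convolution\<close>

lemma is_free_convolution_commute:
  "is_free_convolution \<mu> \<nu> \<rho> \<Longrightarrow> is_free_convolution \<nu> \<mu> \<rho>"
  unfolding is_free_convolution_def by (simp add: Int_commute add.commute)

lemma compact_law_iff: "compact_law M \<longleftrightarrow> compact_prob M"
  by (simp add: compact_law_def compact_law_axioms_def compact_prob_def)

text \<open>Additivity of the R-transforms at \<open>- g\<close>: each one contributes a term
  \<open>1 / g\<close>, and one of the two on the right survives.\<close>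

lemma Stieltjes_inv_free_convolution:
  assumes "compact_prob \<mu>" "compact_prob \<nu>" "is_free_convolution \<mu> \<nu> \<rho>"
    and g: "0 < g" "ereal g < Stieltjes_minus \<mu>" "ereal g < Stieltjes_minus \<nu>" "ereal g < Stieltjes_minus \<rho>"
  shows "Stieltjes_inv \<rho> g = Stieltjes_inv \<mu> g + Stieltjes_inv \<nu> g + 1 / g"
proof -
  interpret m: compact_law \<mu> using assms by (simp add: compact_law_iff)
  interpret n: compact_law \<nu> using assms by (simp add: compact_law_iff)
  interpret r: compact_law \<rho> using assms by (simp add: compact_law_iff is_free_convolution_def)
  have "- g \<in> R_domain \<mu> \<inter> R_domain \<nu>"
    using m.minus_in_Dhat_iff n.minus_in_Dhat_iff m.Dhat_subset_R_domain n.Dhat_subset_R_domain g by blast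
  then have "R_transform \<rho> (- g) = R_transform \<mu> (- g) + R_transform \<nu> (- g)"
    using assms(3) by (simp add: is_free_convolution_def)
  then show ?thesis using g by (simp add: m.R_transform_eq n.R_transform_eq r.R_transform_eq)
qed

text \<open>Solves \<open>F oo A = E\<close> for series with common constant term \<open>c\<close>;
  removing \<open>c\<close> makes the compositional inverse available.\<close>

lemma fps_compose_inv_compose:
  fixes F E :: "real fps"
  assumes F: "fps_nth F 0 = c" "fps_nth F 1 \<noteq> 0" and E: "fps_nth E 0 = c"
  shows "F oo (fps_inv (F - fps_const c) oo (E - fps_const c)) = E"
proof -
  let ?F = "F - fps_const c" and ?E = "E - fps_const c"
  have F': "fps_nth ?F 0 = 0" "fps_nth ?F 1 \<noteq> 0" and E': "fps_nth ?E 0 = 0" using F E by auto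
  have I0: "fps_nth (fps_inv ?F) 0 = 0" by (simp add: fps_inv_def)
  have "?F oo (fps_inv ?F oo ?E) = (?F oo fps_inv ?F) oo ?E"
    by (rule fps_compose_assoc) (use E' I0 in auto)
  also have "?F oo fps_inv ?F = fps_X" using F' by (rule fps_inv_right)
  also have "fps_X oo ?E = ?E" using E' by (auto simp: fps_X_fps_compose fps_eq_iff)
  finally show ?thesis by (simp add: fps_compose_sub_distrib)
qed

lemma Stieltjes_minus_free_convolution_le:
  assumes "compact_prob \<mu>" "compact_prob \<nu>" "is_free_convolution \<mu> \<nu> \<rho>"
  shows "Stieltjes_minus \<rho> \<le> Stieltjes_minus \<mu>"
proof -
  interpret m: compact_law \<mu> using assms by (simp add: compact_law_iff)
  interpret n: compact_law \<nu> using assms by (simp add: compact_law_iff)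
  interpret r: compact_law \<rho> using assms by (simp add: compact_law_iff is_free_convolution_def)
  \<comment> \<open>Every positive \<open>g\<close> below \<open>e\<close> lies in the range of both
    given transforms, so the formula for the inverse functions holds wherever the transform of
    \<rho> is below \<open>e\<close>.\<close>
  define e where "e = min (m.G (m.lo - 1)) (n.G (n.lo - 1))"
  have e: "e > 0" using m.G_pos n.G_pos by (simp add: e_def)
  have "ereal e \<le> ereal (m.G (m.lo - 1))" "ereal e \<le> ereal (n.G (n.lo - 1))" by (auto simp: e_def)
  then have em: "ereal e < Stieltjes_minus \<mu>" and en: "ereal e < Stieltjes_minus \<nu>"
    using m.G_less_Stieltjes_minus[of "m.lo - 1"] n.G_less_Stieltjes_minus[of "n.lo - 1"]
    by (simp, meson le_less_trans)+
  have small: "ereal g < Stieltjes_minus \<mu>" "ereal g < Stieltjes_minus \<nu>" if "g < e" for g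
    using em en that by (auto intro: less_trans[of "ereal g" "ereal e"])
  obtain z1 where z1: "z1 < r.lo" "r.G z1 < e" using r.exists_G_small[OF e] .
  define g1 where "g1 = r.G z1"
  \<comment> \<open>\<open>w\<close> and \<open>v\<close> are the values of the subordination
    functions at \<open>z1\<close>; \<open>A\<close> and \<open>B\<close> below are their increments
    as power series.\<close>
  define w where "w = m.K g1"
  define v where "v = n.K g1"
  have g1: "0 < g1" "g1 < e" using z1 r.G_pos by (auto simp: g1_def)
  have w: "w < m.lo" "m.G w = g1"
    using m.K_less_lo m.G_K g1 small by (auto simp: w_def)
  have v: "v < n.lo" "n.G v = g1"
    using n.K_less_lo n.G_K g1 small by (auto simp: v_def)
  define E where "E = r.Gfps z1"
  define A where "A = fps_inv (m.Gfps w - fps_const g1) oo (E - fps_const g1)"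
  define B where "B = fps_inv (n.Gfps v - fps_const g1) oo (E - fps_const g1)"
  have E: "(\<lambda>h. r.G (z1 + h)) has_fps_expansion E"
    unfolding E_def using z1 by (intro r.G_has_fps_expansion) auto
  have E': "(\<lambda>h. r.G (z1 + h) - g1) has_fps_expansion (E - fps_const g1)"
    by (intro has_fps_expansion_diff E has_fps_expansion_const)
  have E0: "fps_nth E 0 = g1" by (simp add: E_def g1_def r.mom_0)
  then have E'0: "fps_nth (E - fps_const g1) 0 = 0" by simp
  have A: "(\<lambda>h. m.K (r.G (z1 + h)) - w) has_fps_expansion A"
    unfolding A_def using has_fps_expansion_compose_real[OF m.K_has_fps_expansion[of w] E' E'0] w by simp
  have B: "(\<lambda>h. n.K (r.G (z1 + h)) - v) has_fps_expansion B"
    unfolding B_def using has_fps_expansion_compose_real[OF n.K_has_fps_expansion[of v] E' E'0] v by simp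
  have A0: "fps_nth A 0 = 0" and B0: "fps_nth B 0 = 0"
    by (simp_all add: A_def B_def fps_inv_def)
  have MA: "m.Gfps w oo A = E"
    unfolding A_def using w E0 m.mom_1_pos[of w] by (intro fps_compose_inv_compose) (auto simp: m.mom_0)
  have NB: "n.Gfps v oo B = E"
    unfolding B_def using v E0 n.mom_1_pos[of v] by (intro fps_compose_inv_compose) (auto simp: n.mom_0)
  \<comment> \<open>The identity \<open>w + v + 1 / G = z\<close> near \<open>z1\<close>, translated
    to series by uniqueness of expansions.\<close>
  have sum: "A + B + inverse E = fps_X + fps_const (z1 - w - v)"
  proof (rule has_fps_expansion_unique_real)
    show "(\<lambda>h. h + (z1 - w - v)) has_fps_expansion (fps_X + fps_const (z1 - w - v))"
      by (intro has_fps_expansion_add has_fps_expansion_fps_X has_fps_expansion_const)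
    have X: "(\<lambda>h. (m.K (r.G (z1 + h)) - w) + (n.K (r.G (z1 + h)) - v) + inverse (r.G (z1 + h)))
        has_fps_expansion (A + B + inverse E)"
      using E0 g1 by (intro has_fps_expansion_add has_fps_expansion_inverse A B E) auto
    have ev: "eventually (\<lambda>h. (m.K (r.G (z1 + h)) - w) + (n.K (r.G (z1 + h)) - v) +
        inverse (r.G (z1 + h)) = h + (z1 - w - v)) (nhds 0)"
    proof -
      have "isCont r.G z1" using z1 by (intro r.isCont_G) auto
      from isCont_imp_filterlim_nhds[OF this] have "eventually (\<lambda>z. r.G z < e) (nhds z1)"
        using z1(2) by (rule order_tendstoD(2))
      moreover have "eventually (\<lambda>z. z \<in> {..<r.lo}) (nhds z1)"
        using z1 by (intro eventually_nhds_in_open) auto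
      ultimately have "eventually (\<lambda>z. r.G z < e \<and> z < r.lo) (nhds z1)"
        by eventually_elim auto
      then show ?thesis
        unfolding eventually_nhds_shift[of _ z1]
      proof eventually_elim
        case (elim h)
        then have *: "r.K (r.G (z1 + h)) = z1 + h" by (intro r.Stieltjes_inv_G) auto
        have "r.K (r.G (z1 + h)) = m.K (r.G (z1 + h)) + n.K (r.G (z1 + h)) + 1 / r.G (z1 + h)"
          using elim small r.G_less_Stieltjes_minus r.G_pos
          by (intro Stieltjes_inv_free_convolution assms) auto
        with * show ?case by (simp add: inverse_eq_divide)
      qed
    qed
    show "(\<lambda>h. h + (z1 - w - v)) has_fps_expansion (A + B + inverse E)"
      by (rule has_fps_expansion_cong[OF ev refl, THEN iffD1, OF X])
  qed
  have "- inverse E = A + B - (A + B + inverse E)" by simp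
  also have "\<dots> = A + B - fps_X - fps_const (z1 - w - v)" unfolding sum by simp
  finally have invE: "- inverse E = A + B - fps_X + fps_const (- (z1 - w - v))"
    by (simp only: diff_conv_add_uminus fps_const_neg)
  \<comment> \<open>Reciprocals of \<open>G\<^sub>\<mu> \<circ> w = G\<^sub>\<rho>\<close>; together
    with \<open>invE\<close> this is the system treated in
    \<open>subordination_coeffs_nonneg\<close>.\<close>
  have PA: "- inverse (m.Gfps w) oo A = - inverse E"
    using fps_inverse_compose[OF A0, of "m.Gfps w"] m.mom_pos[OF w(1), of 0] MA by (simp add: fps_compose_uminus)
  have QB: "- inverse (n.Gfps v) oo B = - inverse E"
    using fps_inverse_compose[OF B0, of "n.Gfps v"] n.mom_pos[OF v(1), of 0] NB by (simp add: fps_compose_uminus)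
  have "m.mom 1 w * fps_nth A 1 = r.mom 1 z1"
  proof -
    have "fps_nth (m.Gfps w oo A) 1 = m.mom 1 w * fps_nth A 1"
      by (simp add: fps_compose_nth)
    then show ?thesis unfolding MA by (simp add: E_def)
  qed
  then have "0 < m.mom 1 w * fps_nth A 1" using r.mom_pos[OF z1(1), of 1] by simp
  then have A1: "fps_nth A 1 > 0" using m.mom_pos[OF w(1), of 1] by (simp add: zero_less_mult_iff)
  have nn: "fps_nth A n \<ge> 0 \<and> fps_nth B n \<ge> 0" for n
    using w v A0 B0 A1
    by (intro subordination_coeffs_nonneg[OF _ _ _ _ _ _ _ PA[unfolded invE] QB[unfolded invE]]
        m.Gfps_inverse_nonneg m.Gfps_inverse_1 n.Gfps_inverse_nonneg n.Gfps_inverse_1) auto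
  \<comment> \<open>The distance over which \<open>w\<close> has to be followed.\<close>
  define R where "R = r.lo - z1"
  have Esums: "(\<lambda>k. fps_nth E k * x ^ k) sums r.G (z1 + x)" if "0 \<le> x" "x < R" for x
    using that z1 r.G_sums[OF _ r.AE_dist_lower[OF z1(1)], of x] by (simp add: E_def R_def)
  \<comment> \<open>Dropping the nonnegative coefficient of \<open>B\<close> leaves that of
    \<open>fps_X - inverse E\<close>; the extra 1 at index 1 comes from
    \<open>fps_X\<close>.\<close>
  have bound: "fps_nth A k \<le> fps_nth E k / g1\<^sup>2 + (if k = 1 then 1 else 0)" for k
  proof (cases k)
    case 0
    then show ?thesis using A0 E0 g1 by simp
  next
    case (Suc j)
    have "fps_nth A k + fps_nth B k = - fps_nth (inverse E) k + (if k = 1 then 1 else 0)"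
      using arg_cong[OF invE, of "\<lambda>F. fps_nth F k"] Suc by (simp add: fps_X_def)
    moreover have "- fps_nth (inverse E) (Suc j) \<le> fps_nth E (Suc j) / (fps_nth E 0)\<^sup>2"
    proof (rule inverse_coeff_bound)
      show "fps_nth E n \<ge> 0" for n using r.mom_pos[OF z1(1), of n] by (simp add: E_def)
      show "fps_nth (inverse E) (Suc n) \<le> 0" for n
        using r.Gfps_inverse_nonneg[OF z1(1), of "Suc n"] by (simp add: E_def)
    qed (use E0 g1 in simp)
    ultimately show ?thesis using nn[of k] Suc E0 by simp
  qed
  have radius: "ereal x < fps_conv_radius A" if "0 \<le> x" "x < R" for x
  proof -
    \<comment> \<open>Summability at a point only gives \<open>\<le>\<close> for the radius, so a
      slightly larger point is tested.\<close>
    define x' where "x' = (x + R) / 2"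
    have x': "x < x'" "x' < R" "0 \<le> x'" using that by (auto simp: x'_def)
    have "summable (\<lambda>k. fps_nth A k * x' ^ k)"
    proof (rule summable_comparison_test')
      have "(\<lambda>k. fps_nth E k * x' ^ k / g1\<^sup>2 + (if k = 1 then x' else 0)) sums (r.G (z1 + x') / g1\<^sup>2 + x')"
        using x' by (intro sums_add sums_divide Esums sums_single) auto
      then show "summable (\<lambda>k. fps_nth E k * x' ^ k / g1\<^sup>2 + (if k = 1 then x' else 0))"
        by (rule sums_summable)
      fix k :: nat
      have "fps_nth A k * x' ^ k \<le> (fps_nth E k / g1\<^sup>2 + (if k = 1 then 1 else 0)) * x' ^ k"
        using bound x' by (intro mult_right_mono) auto
      also have "\<dots> = fps_nth E k * x' ^ k / g1\<^sup>2 + (if k = 1 then x' else 0)"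
        by (simp add: algebra_simps)
      finally show "norm (fps_nth A k * x' ^ k) \<le> fps_nth E k * x' ^ k / g1\<^sup>2 + (if k = 1 then x' else 0)"
        using nn[of k] x' by simp
    qed
    then have "ereal (norm x') \<le> fps_conv_radius A"
      unfolding fps_conv_radius_def by (rule conv_radius_geI)
    moreover have "ereal x < ereal (norm x')" using x' by simp
    ultimately show ?thesis by (rule less_le_trans[rotated])
  qed
  \<comment> \<open>Rearranging the series of \<open>G\<^sub>\<rho>\<close> shows that the Taylor
    series of \<open>G\<^sub>\<mu>\<close> at \<open>w\<close> converges at
    \<open>eval_fps A x\<close>, which bounds the argument by \<open>m.lo\<close>.\<close>
  have yle: "w + eval_fps A x \<le> m.lo"
    and ysums: "(\<lambda>n. m.mom n w * eval_fps A x ^ n) sums r.G (z1 + x)" if "0 \<le> x" "x < R" for x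
  proof -
    have "(\<lambda>n. fps_nth (m.Gfps w) n * eval_fps A x ^ n) sums r.G (z1 + x)"
    proof (rule compose_sums_nonneg)
      show "fps_nth (m.Gfps w) n \<ge> 0" for n using m.mom_pos[OF w(1), of n] by simp
      show "(\<lambda>k. fps_nth (m.Gfps w oo A) k * x ^ k) sums r.G (z1 + x)"
        unfolding MA using that by (rule Esums)
    qed (use nn A0 that radius in auto)
    then show "(\<lambda>n. m.mom n w * eval_fps A x ^ n) sums r.G (z1 + x)" by simp
    then show "w + eval_fps A x \<le> m.lo"
      using w by (intro m.summable_imp_le_lo) (auto dest: sums_summable)
  qed
  \<comment> \<open>Since \<open>A\<close> has nonnegative coefficients and a positive linear one,
    it increases strictly, so the weak bound at \<open>x'\<close> becomes strict at
    \<open>x\<close>. There the rearranged series sums to a true value of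
    \<open>G\<^sub>\<mu>\<close>.\<close>
  have key: "ereal (r.G (z1 + x)) < Stieltjes_minus \<mu>" if x: "0 \<le> x" "x < R" for x
  proof -
    define x' where "x' = (x + R) / 2"
    have x': "x < x'" "x' < R" "0 \<le> x'" using that by (auto simp: x'_def)
    have s: "(\<lambda>k. fps_nth A k * t ^ k) sums eval_fps A t" if "0 \<le> t" "t < R" for t
      using that radius by (intro sums_eval_fps) auto
    have "(\<lambda>k. fps_nth A k * x ^ k + (if k = 1 then fps_nth A 1 * (x' - x) else 0)) sums
        (eval_fps A x + fps_nth A 1 * (x' - x))"
      using x by (intro sums_add s sums_single) auto
    then have "eval_fps A x + fps_nth A 1 * (x' - x) \<le> eval_fps A x'"
    proof (rule sums_le[rotated])
      show "(\<lambda>k. fps_nth A k * x' ^ k) sums eval_fps A x'" using x' by (intro s) auto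
      fix k :: nat
      have "fps_nth A k * x ^ k \<le> fps_nth A k * x' ^ k"
        using nn[of k] x x' by (intro mult_left_mono power_mono) auto
      then show "fps_nth A k * x ^ k + (if k = 1 then fps_nth A 1 * (x' - x) else 0) \<le> fps_nth A k * x' ^ k"
        by (auto simp: algebra_simps)
    qed
    moreover have "fps_nth A 1 * (x' - x) > 0" using A1 x' by simp
    ultimately have y: "w + eval_fps A x < m.lo" using yle[of x'] x' by linarith
    have y0: "eval_fps A x \<ge> 0"
      by (rule sums_le[OF _ sums_zero s[OF x]]) (use nn x in auto)
    have "(\<lambda>n. m.mom n w * eval_fps A x ^ n) sums m.G (w + eval_fps A x)"
      using y y0 w by (intro m.G_sums[OF _ m.AE_dist_lower[OF w(1)]]) auto
    with ysums[OF x] have "r.G (z1 + x) = m.G (w + eval_fps A x)" by (rule sums_unique2)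
    then show ?thesis using m.G_less_Stieltjes_minus[OF y] by simp
  qed
  show ?thesis
    unfolding r.Stieltjes_minus_eq
  proof (rule SUP_least)
    fix z assume z: "z \<in> {..<r.lo}"
    show "ereal (r.G z) \<le> Stieltjes_minus \<mu>"
    proof (cases "z1 \<le> z")
      case True
      then show ?thesis using key[of "z - z1"] z by (simp add: R_def)
    next
      case False
      then have "r.G z < r.G z1" using z1 by (intro r.G_strict_mono_lower) auto
      then show ?thesis using z1(2) small(1)[of "r.G z"] by simp
    qed
  qed
qed

section \<open>The variational formula\<close>

context compact_law
begin

section \<open>The logarithmic potential to the left of the support\<close>

abbreviation "U \<equiv> log_potential M"

lemma log_potential_eq: "z < lo \<Longrightarrow> U z = (\<integral>x. ln (x - z) \<partial>M)"
  unfolding log_potential_def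
  by (intro integral_cong_AE) (use AE_bounds in \<open>auto elim!: eventually_mono\<close>)

lemma AE_ln_bounds:
  assumes "z < lo"
  shows "AE x in M. ln (lo - z) \<le> ln (x - z) \<and> ln (x - z) \<le> ln (hi - z)"
  using AE_bounds by eventually_elim (use assms in auto)

lemma integrable_ln:
  assumes "z < lo" shows "integrable M (\<lambda>x. ln (x - z))"
proof (rule integrable_bounded)
  show "AE x in M. \<bar>ln (x - z)\<bar> \<le> max \<bar>ln (lo - z)\<bar> \<bar>ln (hi - z)\<bar>"
    using AE_ln_bounds[OF assms] by eventually_elim auto
qed measurable

lemma log_potential_bounds:
  assumes "z < lo" shows "ln (lo - z) \<le> U z" "U z \<le> ln (hi - z)"
proof -
  have "(\<integral>x. ln (lo - z) \<partial>M) \<le> (\<integral>x. ln (x - z) \<partial>M)"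
    by (intro integral_mono_AE integrable_ln assms)
      (use AE_ln_bounds[OF assms] in \<open>auto elim: eventually_mono\<close>)
  then show "ln (lo - z) \<le> U z" using assms by (simp add: log_potential_eq)
  have "(\<integral>x. ln (x - z) \<partial>M) \<le> (\<integral>x. ln (hi - z) \<partial>M)"
    by (intro integral_mono_AE integrable_ln assms)
      (use AE_ln_bounds[OF assms] in \<open>auto elim: eventually_mono\<close>)
  then show "U z \<le> ln (hi - z)" using assms by (simp add: log_potential_eq)
qed

text \<open>The quadratic error of \<open>ln (1 + t)\<close> at \<open>t = - h / (x - z)\<close>,
  uniform over the support because \<open>\<bar>t\<bar> \<le> 1 / 2\<close> there. Integrating it
  yields the derivative of \<open>U\<close>.\<close>

lemma log_potential_increment:
  assumes z: "z < lo" and h: "\<bar>h\<bar> \<le> (lo - z) / 2"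
  shows "\<bar>U (z + h) - U z + h * G z\<bar> \<le> 2 * h\<^sup>2 / (lo - z)\<^sup>2"
proof -
  define d where "d = lo - z"
  have d: "d > 0" using z by (simp add: d_def)
  have zh: "z + h < lo" using z h by (auto simp: abs_le_iff field_simps)
  have z': "z \<notin> {lo..hi}" using z by auto
  let ?f = "\<lambda>x. ln (x - (z + h)) - ln (x - z) + h * (1 / (x - z))"
  have int: "integrable M ?f"
    by (intro Bochner_Integration.integrable_add Bochner_Integration.integrable_diff
        integrable_mult_right integrable_ln integrable_resolvent z z' zh)
  have "U (z + h) - U z + h * G z = (\<integral>x. ?f x \<partial>M)"
    using z zh integrable_ln[OF z] integrable_ln[OF zh] integrable_resolvent[OF z']
    by (simp add: log_potential_eq Stieltjes_def del: times_divide_eq_right)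
  also have "\<bar>\<dots>\<bar> \<le> (\<integral>x. 2 * h\<^sup>2 / d\<^sup>2 \<partial>M)"
  proof (rule order_trans[OF integral_abs_bound])
    show "(\<integral>x. \<bar>?f x\<bar> \<partial>M) \<le> (\<integral>x. 2 * h\<^sup>2 / d\<^sup>2 \<partial>M)"
    proof (rule integral_mono_AE)
      show "AE x in M. \<bar>?f x\<bar> \<le> 2 * h\<^sup>2 / d\<^sup>2"
        using AE_bounds
      proof eventually_elim
        case (elim x)
        define X where "X = x - z"
        have X: "d \<le> X" using elim by (auto simp: X_def d_def)
        have "\<bar>h\<bar> \<le> X / 2" using h X by (simp add: d_def)
        then have small: "\<bar>- h / X\<bar> \<le> 1 / 2" using X d by (simp add: field_simps)
        then have pos: "1 + - h / X > 0" by linarith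
        have "x - (z + h) = X * (1 + - h / X)"
        proof -
          have "X \<noteq> 0" using X d by simp
          then have "X * (1 + - h / X) = X - h" by (simp add: field_simps)
          then show ?thesis by (simp add: X_def)
        qed
        then have "ln (x - (z + h)) = ln (X * (1 + - h / X))" by simp
        also have "\<dots> = ln X + ln (1 + - h / X)"
          using X d pos by (intro ln_mult_pos) auto
        finally have "?f x = ln (1 + - h / X) - (- h / X)" by (simp add: X_def)
        then have "\<bar>?f x\<bar> \<le> 2 * (- h / X)\<^sup>2"
          using abs_ln_one_plus_x_minus_x_bound[OF small] by simp
        also have "\<dots> = 2 * h\<^sup>2 / X\<^sup>2" by (simp add: power_divide)
        also have "\<dots> \<le> 2 * h\<^sup>2 / d\<^sup>2"
          using X d by (intro divide_left_mono power_mono mult_pos_pos) auto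
        finally show ?case .
      qed
    qed (use int in auto)
  qed
  finally show ?thesis by (simp add: d_def)
qed

lemma DERIV_log_potential:
  assumes z: "z < lo"
  shows "(U has_real_derivative - G z) (at z)"
  unfolding DERIV_def
proof (subst LIM_zero_iff[symmetric], rule Lim_null_comparison)
  define d where "d = lo - z"
  have d: "d > 0" using z by (simp add: d_def)
  show "((\<lambda>h. 2 * \<bar>h\<bar> / d\<^sup>2) \<longlongrightarrow> 0) (at 0)"
    by (rule tendsto_eq_intros refl | use d in simp)+
  have "eventually (\<lambda>h. h \<in> ball 0 (d / 2)) (at (0::real))"
    using d by (intro eventually_at_in_open') auto
  moreover have "eventually (\<lambda>h::real. h \<noteq> 0) (at 0)" by (simp add: eventually_at_filter)
  ultimately show "eventually (\<lambda>h. norm ((U (z + h) - U z) / h - - G z) \<le> 2 * \<bar>h\<bar> / d\<^sup>2) (at 0)"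
  proof eventually_elim
    case (elim h)
    have "\<bar>(U (z + h) - U z) / h - - G z\<bar> = \<bar>U (z + h) - U z + h * G z\<bar> / \<bar>h\<bar>"
      using elim(2) by (simp add: field_simps flip: abs_divide)
    also have "\<dots> \<le> (2 * h\<^sup>2 / d\<^sup>2) / \<bar>h\<bar>"
      using log_potential_increment[OF z, of h] elim by (intro divide_right_mono) (auto simp: d_def)
    also have "\<dots> = 2 * \<bar>h\<bar> / d\<^sup>2"
      using elim(2) by (simp add: power2_eq_square field_simps abs_if)
    finally show ?case by simp
  qed
qed

lemma G_lower_bound_left:
  assumes "z < lo" shows "1 / (hi - z) \<le> G z"
proof -
  have "AE x in M. 1 / (hi - z) \<le> 1 / (x - z)"
    using AE_bounds by eventually_elim (use assms in \<open>auto intro!: divide_left_mono\<close>)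
  then have "(\<integral>x. 1 / (hi - z) \<partial>M) \<le> (\<integral>x. 1 / (x - z) \<partial>M)"
    using assms by (intro integral_mono_AE integrable_resolvent) auto
  then show ?thesis by (simp add: Stieltjes_def)
qed

text \<open>Both \<open>U w\<close> and \<open>- ln (G w)\<close> lie between
  \<open>ln (lo - w)\<close> and \<open>ln (hi - w)\<close>, whose difference vanishes as
  \<open>w = K s\<close> tends to minus infinity. The divergent \<open>ln s\<close> will cancel
  between two laws.\<close>

lemma log_potential_K_near_0:
  "((\<lambda>s. U (K s) + ln s) \<longlongrightarrow> 0) (at_right 0)"
proof (rule Lim_null_comparison)
  define D where "D = hi - lo"
  have D: "D \<ge> 0" using lo_le_hi by (simp add: D_def)
  show "((\<lambda>s. D * s / (1 - D * s)) \<longlongrightarrow> 0) (at_right 0)"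
    by (rule tendsto_eq_intros refl | simp)+
  obtain e where e: "e > 0" "ereal e < Stieltjes_minus M"
    using G_pos[of "lo - 1"] G_less_Stieltjes_minus[of "lo - 1"] by auto
  \<comment> \<open>Below \<open>1 / (D + 1)\<close> one has \<open>D * s < 1\<close>, so the
    denominators in the bound are positive.\<close>
  have "min e (1 / (D + 1)) > 0" using e D by simp
  from eventually_at_right_real[OF this]
  show "eventually (\<lambda>s. norm (U (K s) + ln s) \<le> D * s / (1 - D * s)) (at_right 0)"
  proof eventually_elim
    case (elim s)
    then have s: "0 < s" "s < e" "s * (D + 1) < 1" using D by (auto simp: field_simps)
    then have "ereal s < Stieltjes_minus M" using e(2) by (meson less_trans ereal_less(2) less_ereal.simps(1))
    with s have w: "K s < lo" "G (K s) = s" using K_less_lo G_K by auto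
    define w where "w = K s"
    have lw: "lo - w > 0" and hw: "hi - w > 0" using w lo_le_hi by (auto simp: w_def)
    have s1: "1 / (hi - w) \<le> s" and s2: "s \<le> 1 / (lo - w)"
      using G_lower_bound_left[OF w(1)] G_upper_bound[OF w(1)] w(2) by (simp_all add: w_def)
    have "ln (1 / (hi - w)) \<le> ln s" using s1 hw s by simp
    moreover have "ln s \<le> ln (1 / (lo - w))" using s2 lw s by simp
    ultimately have "\<bar>U w + ln s\<bar> \<le> ln (hi - w) - ln (lo - w)"
      using log_potential_bounds[OF w(1)] lw hw by (auto simp: w_def ln_div abs_le_iff)
    also have "\<dots> = ln (1 + D / (lo - w))"
    proof -
      have "1 + D / (lo - w) = (hi - w) / (lo - w)" using lw by (simp add: D_def field_simps)
      then show ?thesis using lw hw by (simp add: ln_div)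
    qed
    also have "\<dots> \<le> D / (lo - w)"
      using lw D by (intro ln_add_one_self_le_self) simp
    also have "\<dots> \<le> D / (1 / s - D)"
    proof (rule divide_left_mono)
      have "1 / s \<le> hi - w" using s1 hw s by (simp add: field_simps)
      then show "1 / s - D \<le> lo - w" by (simp add: D_def)
      have "0 < 1 / s - D" using s by (simp add: field_simps)
      with lw show "0 < (lo - w) * (1 / s - D)" by simp
    qed (rule D)
    also have "\<dots> = D * s / (1 - D * s)" using s by (simp add: field_simps)
    finally show ?case by (simp add: w_def)
  qed
qed

text \<open>In the coordinate \<open>w = K g\<close> the value is \<open>w + 1 / G w\<close>, with
  derivative \<open>1 - mom 1 w / (G w)\<^sup>2\<close>, negative by strict variance.\<close>

lemma R_transform_strict_antimono:
  assumes nd: "non_degenerate M" and g: "0 < g" "g < h" "ereal h < Stieltjes_minus M"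
  shows "R_transform M (- h) < R_transform M (- g)"
proof -
  have g': "ereal g < Stieltjes_minus M" using g by (meson less_trans less_ereal.simps(1))
  have wg: "K g < lo" "G (K g) = g" and wh: "K h < lo" "G (K h) = h"
    using g g' K_less_lo G_K by auto
  have "K g < K h" using wg wh g(2) G_strict_mono_lower[of "K h" "K g"]
    by (cases "K g" "K h" rule: linorder_cases) auto
  then have "K h + 1 / G (K h) < K g + 1 / G (K g)"
  proof (rule DERIV_neg_imp_decreasing[of _ _ "\<lambda>w. w + 1 / G w"])
    fix w assume "K g \<le> w" "w \<le> K h"
    then have w: "w < lo" using wh by simp
    then have w': "w \<notin> {lo..hi}" by auto
    have G0: "G w > 0" using w by (rule G_pos)
    have "((\<lambda>w. w + 1 / G w) has_real_derivative 1 - mom 1 w / (G w)\<^sup>2) (at w)"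
      by (rule derivative_eq_intros DERIV_G[OF w'] refl | use G0 in \<open>simp add: power2_eq_square\<close>)+
    moreover have "1 - mom 1 w / (G w)\<^sup>2 < 0"
      using mom_1_strict[OF nd w'] G0 by simp
    ultimately show "\<exists>y. ((\<lambda>w. w + 1 / G w) has_real_derivative y) (at w) \<and> y < 0" by blast
  qed
  then show ?thesis using g g' wg wh by (simp add: R_transform_eq)
qed

end

lemma arg_min_INF_unique:
  fixes f :: "real \<Rightarrow> real"
  assumes g0: "g0 \<in> S" and min: "\<And>g. g \<in> S \<Longrightarrow> g \<noteq> g0 \<Longrightarrow> f g0 < f g"
  shows "f g0 = (INF g\<in>S. f g)" and "is_arg_min f (\<lambda>g. g \<in> S) g \<longleftrightarrow> g = g0"
proof -
  have le: "f g0 \<le> f g" if "g \<in> S" for g using min[OF that] by (cases "g = g0") auto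
  show "f g0 = (INF g\<in>S. f g)"
    by (rule cInf_eq_minimum[symmetric]) (use g0 le in auto)
  show "is_arg_min f (\<lambda>g. g \<in> S) g \<longleftrightarrow> g = g0"
    unfolding is_arg_min_def using g0 min le by (metis not_less)
qed

section \<open>Evaluation of the functional and its strict minimum\<close>

locale free_convolution_laws =
  m: compact_law \<mu> + n: compact_law \<nu> + r: compact_law \<rho> for \<mu> \<nu> \<rho> +
  assumes conv: "is_free_convolution \<mu> \<nu> \<rho>"
begin

lemma compact_probs: "compact_prob \<mu>" "compact_prob \<nu>" "compact_prob \<rho>"
  using m.compact_law_axioms n.compact_law_axioms r.compact_law_axioms by (simp_all add: compact_law_iff)

text \<open>The inclusion of ranges for both factors, the second by commutativity.\<close>

lemma less_both:
  assumes "ereal g < Stieltjes_minus \<rho>"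
  shows "ereal g < Stieltjes_minus \<mu>" "ereal g < Stieltjes_minus \<nu>"
  using assms Stieltjes_minus_free_convolution_le[OF compact_probs(1,2) conv]
    Stieltjes_minus_free_convolution_le[OF compact_probs(2,1) is_free_convolution_commute[OF conv]]
  by (auto intro: less_le_trans)

lemma R_transform_eq_diff:
  assumes "0 < g" "ereal g < Stieltjes_minus \<rho>"
  shows "R_transform \<mu> (- g) = r.K g - n.K g"
  using assms less_both[OF assms(2)] Stieltjes_inv_free_convolution[OF compact_probs(1,2) conv]
  by (simp add: m.R_transform_eq)

text \<open>Each term differentiates to \<open>- s\<close> times the derivative of its
  \<open>K\<close>, because \<open>G (K s) = s\<close>; the difference of the two functions
  \<open>K\<close> is \<open>R_transform \<mu> (- s)\<close>.\<close>

lemma DERIV_potential_difference: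
  assumes s: "0 < s" "ereal s < Stieltjes_minus \<rho>"
  shows "((\<lambda>s. r.U (r.K s) - n.U (n.K s)) has_real_derivative s * deriv (R_transform \<mu>) (- s)) (at s)"
proof -
  have r: "r.K s < r.lo" "r.G (r.K s) = s" and n: "n.K s < n.lo" "n.G (n.K s) = s"
    using s less_both r.K_less_lo r.G_K n.K_less_lo n.G_K by auto
  have Dr: "(r.K has_real_derivative deriv r.K s) (at s)"
    using r.real_analytic_at_K[of "r.K s"] r by (intro real_analytic_at_imp_DERIV) auto
  have Dn: "(n.K has_real_derivative deriv n.K s) (at s)"
    using n.real_analytic_at_K[of "n.K s"] n by (intro real_analytic_at_imp_DERIV) auto
  have "- s \<in> R_domain \<mu>"
    using m.minus_in_Dhat_iff m.Dhat_subset_R_domain s less_both by blast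
  then have DP: "(R_transform \<mu> has_real_derivative deriv (R_transform \<mu>) (- s)) (at (- s))"
    by (intro real_analytic_at_imp_DERIV m.real_analytic_at_R_transform)
  have DP': "((\<lambda>s. R_transform \<mu> (- s)) has_real_derivative - deriv (R_transform \<mu>) (- s)) (at s)"
  proof -
    have "(uminus has_real_derivative - 1) (at s)" by (auto intro!: derivative_eq_intros)
    from DERIV_chain2[of "R_transform \<mu>" _ uminus s, OF DP this] show ?thesis by simp
  qed
  \<comment> \<open>Differentiating the identity requires it near \<open>s\<close>; a value of
    \<open>G\<^sub>\<rho>\<close> above \<open>s\<close> provides the room.\<close>
  have ev: "eventually (\<lambda>s. R_transform \<mu> (- s) = r.K s - n.K s) (nhds s)"
  proof -
    obtain z where z: "z < r.lo" "s < r.G z" using s(2) by (auto simp: r.less_Stieltjes_minus_iff)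
    have "eventually (\<lambda>t. t \<in> {0<..<r.G z}) (nhds s)"
      using s z by (intro eventually_nhds_in_open) auto
    then show ?thesis
    proof eventually_elim
      case (elim t)
      then show ?case using z by (intro R_transform_eq_diff) (auto simp: r.less_Stieltjes_minus_iff)
    qed
  qed
  have "((\<lambda>s. r.K s - n.K s) has_real_derivative - deriv (R_transform \<mu>) (- s)) (at s)"
    by (rule DERIV_cong_ev[OF refl ev refl, THEN iffD1, OF DP'])
  moreover have "((\<lambda>s. r.K s - n.K s) has_real_derivative deriv r.K s - deriv n.K s) (at s)"
    using Dr Dn by (rule DERIV_diff)
  ultimately have eq: "- deriv (R_transform \<mu>) (- s) = deriv r.K s - deriv n.K s"
    by (rule DERIV_unique)
  have "((\<lambda>s. r.U (r.K s) - n.U (n.K s)) has_real_derivative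
      - r.G (r.K s) * deriv r.K s - - n.G (n.K s) * deriv n.K s) (at s)"
    by (intro DERIV_diff DERIV_chain2[OF r.DERIV_log_potential Dr] DERIV_chain2[OF n.DERIV_log_potential Dn] r n)
  also have "- r.G (r.K s) * deriv r.K s - - n.G (n.K s) * deriv n.K s = s * deriv (R_transform \<mu>) (- s)"
    using r n arg_cong[OF eq, of "\<lambda>t. s * t"] by (simp add: algebra_simps)
  finally show ?thesis .
qed

text \<open>Fundamental theorem of calculus on the open interval. The integrand extends continuously
  to 0, where the R-transform is analytic, although both functions \<open>K\<close> diverge
  there.\<close>

lemma integral_R_transform:
  assumes g: "0 < g" "ereal g < Stieltjes_minus \<rho>"
  shows "(LBINT s=ereal 0..ereal g. s * deriv (R_transform \<mu>) (- s)) = r.U (r.K g) - n.U (n.K g)"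
proof -
  let ?f = "\<lambda>s. s * deriv (R_transform \<mu>) (- s)" and ?F = "\<lambda>s. r.U (r.K s) - n.U (n.K s)"
  have cont: "isCont ?f s" if "0 \<le> s" "s \<le> g" for s
  proof -
    have "- s \<in> Dhat \<mu>"
    proof (cases "s = 0")
      case False
      have "ereal s < Stieltjes_minus \<mu>"
        using that less_both(1)[OF g(2)] by (meson ereal_less_eq(3) le_less_trans)
      then show ?thesis using False that m.minus_in_Dhat_iff by simp
    qed (use m.zero_in_Dhat in simp)
    then have "real_analytic_at (R_transform \<mu>) (- s)"
      using m.Dhat_subset_R_domain m.real_analytic_at_R_transform by blast
    then have "isCont (deriv (R_transform \<mu>)) (- s)"
      by (intro real_analytic_at_imp_isCont real_analytic_at_deriv)
    then have "isCont (\<lambda>s. deriv (R_transform \<mu>) (- s)) s"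
      using isCont_o2[of s uminus "deriv (R_transform \<mu>)"] by simp
    then show ?thesis by (rule isCont_mult[OF continuous_ident])
  qed
  have "(LBINT s=ereal 0..ereal g. ?f s) = ?F g - 0"
  proof (rule interval_integral_FTC_integrable)
    show "(?F has_vector_derivative ?f s) (at s)" if "ereal 0 < ereal s" "ereal s < ereal g" for s
      unfolding has_real_derivative_iff_has_vector_derivative[symmetric]
    proof (rule DERIV_potential_difference)
      show "ereal s < Stieltjes_minus \<rho>" using that(2) g(2) by (rule less_trans)
    qed (use that in simp)
    show "isCont ?f s" if "ereal 0 < ereal s" "ereal s < ereal g" for s
      using that by (intro cont) auto
    have "set_integrable lborel {0..g} ?f"
      by (intro borel_integrable_atLeastAtMost' continuous_at_imp_continuous_on) (use cont in auto)
    then show "set_integrable lborel (einterval (ereal 0) (ereal g)) ?f"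
      by (rule set_integrable_subset) (auto simp: einterval_def)
    \<comment> \<open>The logarithmic singularities of the two potentials cancel, so the boundary
      term at 0 is zero.\<close>
    have "((\<lambda>s. (r.U (r.K s) + ln s) - (n.U (n.K s) + ln s)) \<longlongrightarrow> 0 - 0) (at_right 0)"
      by (intro tendsto_diff r.log_potential_K_near_0 n.log_potential_K_near_0)
    then show "((?F \<circ> real_of_ereal) \<longlongrightarrow> 0) (at_right (ereal 0))"
      unfolding ereal_tendsto_simps1(2) by simp
    have "isCont ?F g" using DERIV_potential_difference[OF g] by (rule DERIV_isCont)
    then show "((?F \<circ> real_of_ereal) \<longlongrightarrow> ?F g) (at_left (ereal g))"
      unfolding ereal_tendsto_simps1(1) isCont_def by (rule filterlim_mono[OF _ order_refl at_le]) simp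
  qed (use g in simp)
  then show ?thesis by simp
qed

lemma E_fun_eq:
  assumes g: "0 < g" "ereal g < Stieltjes_minus \<rho>" and z: "z - R_transform \<mu> (- g) < n.lo"
  shows "E_fun \<mu> \<nu> z g = r.U (r.K g) - n.U (n.K g) + n.U (z - R_transform \<mu> (- g))"
  using n.log_potential_eq[OF z] by (simp add: E_fun_def integral_R_transform[OF g] diff_diff_eq2 diff_add_eq)

text \<open>Here \<open>z - R_transform \<mu> (- g)\<close> equals \<open>n.K g\<close>, so the two
  potentials of \<nu> cancel.\<close>

lemma E_fun_at_minimizer:
  assumes z: "z < r.lo"
  shows "z - R_transform \<mu> (- r.G z) < n.lo" and "E_fun \<mu> \<nu> z (r.G z) = r.U z"
proof -
  have g: "0 < r.G z" "ereal (r.G z) < Stieltjes_minus \<rho>"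
    using z r.G_pos r.G_less_Stieltjes_minus by auto
  have rK: "r.K (r.G z) = z" using z by (intro r.Stieltjes_inv_G) auto
  then have eq: "z - R_transform \<mu> (- r.G z) = n.K (r.G z)"
    using R_transform_eq_diff[OF g] by simp
  then show "z - R_transform \<mu> (- r.G z) < n.lo"
    using n.K_less_lo g less_both by simp
  then show "E_fun \<mu> \<nu> z (r.G z) = r.U z"
    using E_fun_eq[OF g] eq rK by simp
qed

text \<open>With \<open>c\<close> frozen, the derivative of \<open>\<phi>\<close> compares
  \<open>n.G\<close> at \<open>s - c\<close> with \<open>n.G\<close> at
  \<open>s - R_transform \<mu> (- r.G s)\<close>, whose value is \<open>r.G s\<close>. Strict
  antitonicity of the R-transform decides the sign on either side of \<open>y\<close>.\<close>

lemma E_fun_greater: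
  assumes nd: "non_degenerate \<mu>" and z: "z < r.lo"
    and g: "0 < g" "ereal g < Stieltjes_minus \<rho>" and zg: "z - R_transform \<mu> (- g) < n.lo"
    and ne: "g \<noteq> r.G z"
  shows "r.U z < E_fun \<mu> \<nu> z g"
proof -
  define c where "c = R_transform \<mu> (- g)"
  define y where "y = r.K g"
  define \<phi> where "\<phi> s = r.U s - n.U (s - c)" for s
  have y: "y < r.lo" "r.G y = g" using g r.K_less_lo r.G_K by (auto simp: y_def)
  have nK: "n.K g = y - c" using R_transform_eq_diff[OF g] by (simp add: c_def y_def)
  have yc: "y - c < n.lo" using n.K_less_lo[OF g(1) less_both(2)[OF g(2)]] nK by simp
  have D: "(\<phi> has_real_derivative n.G (s - c) - r.G s) (at s)" if "s < r.lo" "s - c < n.lo" for s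
  proof -
    have "((\<lambda>s. n.U (s - c)) has_real_derivative - n.G (s - c) * 1) (at s)"
      by (rule DERIV_chain2[of n.U _ "\<lambda>s. s - c", OF n.DERIV_log_potential[OF that(2)]])
        (auto intro!: derivative_eq_intros)
    from DERIV_diff[OF r.DERIV_log_potential[OF that(1)] this] show ?thesis
      unfolding \<phi>_def by (simp add: algebra_simps)
  qed
  have sub: "n.K (r.G s) = s - R_transform \<mu> (- r.G s)" "n.K (r.G s) < n.lo" "n.G (n.K (r.G s)) = r.G s"
    if "s < r.lo" for s
  proof -
    have h: "0 < r.G s" "ereal (r.G s) < Stieltjes_minus \<rho>"
      using that r.G_pos r.G_less_Stieltjes_minus by auto
    show "n.K (r.G s) = s - R_transform \<mu> (- r.G s)"
      using R_transform_eq_diff[OF h] r.Stieltjes_inv_G[of s] that by simp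
    show "n.K (r.G s) < n.lo" "n.G (n.K (r.G s)) = r.G s"
      using h less_both n.K_less_lo n.G_K by auto
  qed
  have "\<phi> z < \<phi> y"
  proof (cases "z < y")
    \<comment> \<open>Between \<open>z\<close> and \<open>y\<close>, \<open>s - c\<close> stays
      below \<open>y - c = n.K g\<close>, hence left of the support of \<nu>.\<close>
    case True
    then show ?thesis
    proof (rule DERIV_pos_imp_increasing_open)
      fix s assume s: "z < s" "s < y"
      then have sl: "s < r.lo" "s - c < n.lo" using y yc by auto
      have "r.G s < g" using s y r.G_strict_mono_lower[of s y] by simp
      then have "c < R_transform \<mu> (- r.G s)"
        unfolding c_def using sl r.G_pos less_both(1)[OF g(2)]
        by (intro m.R_transform_strict_antimono nd) auto
      then have "n.K (r.G s) < s - c" using sub(1)[OF sl(1)] by simp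
      then have "r.G s < n.G (s - c)"
        using n.G_strict_mono_lower[of "n.K (r.G s)" "s - c"] sub(3)[OF sl(1)] sl by simp
      then show "\<exists>d. (\<phi> has_real_derivative d) (at s) \<and> 0 < d"
        using D[OF sl] by (intro exI[of _ "n.G (s - c) - r.G s"]) auto
    next
      show "continuous_on {z..y} \<phi>"
        by (intro continuous_at_imp_continuous_on ballI DERIV_isCont[OF D]) (use y yc in auto)
    qed
  next
    \<comment> \<open>Between \<open>y\<close> and \<open>z\<close>, the constraint
      \<open>zg\<close> keeps \<open>s - c\<close> left of the support of \<nu>.\<close>
    case False
    moreover have "y \<noteq> z" using ne y by auto
    ultimately have "y < z" by simp
    then show ?thesis
    proof (rule DERIV_neg_imp_decreasing_open)
      fix s assume s: "y < s" "s < z"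
      then have sl: "s < r.lo" "s - c < n.lo" using z zg by (auto simp: c_def)
      have "g < r.G s" using s y sl r.G_strict_mono_lower[of y s] by simp
      then have "R_transform \<mu> (- r.G s) < c"
        unfolding c_def using less_both(1)[OF r.G_less_Stieltjes_minus[OF sl(1)]] g
        by (intro m.R_transform_strict_antimono nd) auto
      then have "s - c < n.K (r.G s)" using sub(1)[OF sl(1)] by simp
      then have "n.G (s - c) < r.G s"
        using n.G_strict_mono_lower[of "s - c" "n.K (r.G s)"] sub[OF sl(1)] by simp
      then show "\<exists>d. (\<phi> has_real_derivative d) (at s) \<and> d < 0"
        using D[OF sl] by (intro exI[of _ "n.G (s - c) - r.G s"]) auto
    next
      show "continuous_on {y..z} \<phi>"
        by (intro continuous_at_imp_continuous_on ballI DERIV_isCont[OF D]) (use z zg in \<open>auto simp: c_def\<close>)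
    qed
  qed
  then show ?thesis
    using E_fun_eq[OF g zg] nK by (simp add: \<phi>_def y_def c_def)
qed

end

theorem theorem1p1:
  fixes \<mu> \<nu> \<rho> :: "real measure" and z :: real
  assumes "compact_prob \<mu>" and "compact_prob \<nu>" and "non_degenerate \<mu>"
    and "is_free_convolution \<mu> \<nu> \<rho>"
    and "z < supp_minus \<rho>"
  shows "log_potential \<rho> z =
           (INF g \<in> Ehat_set \<mu> \<nu> z \<inter> {g. 0 < g \<and> ereal g < Stieltjes_minus \<rho>}. E_fun \<mu> \<nu> z g) \<and>
         log_potential \<rho> z =
           (INF g \<in> E_set \<mu> \<nu> z \<inter> {g. 0 < g \<and> ereal g < Stieltjes_minus \<rho>}. E_fun \<mu> \<nu> z g) \<and>
         (\<forall>g. is_arg_min (E_fun \<mu> \<nu> z)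
                (\<lambda>g. g \<in> Ehat_set \<mu> \<nu> z \<inter> {g. 0 < g \<and> ereal g < Stieltjes_minus \<rho>}) g
              \<longleftrightarrow> g = Stieltjes \<rho> z) \<and>
         (\<forall>g. is_arg_min (E_fun \<mu> \<nu> z)
                (\<lambda>g. g \<in> E_set \<mu> \<nu> z \<inter> {g. 0 < g \<and> ereal g < Stieltjes_minus \<rho>}) g
              \<longleftrightarrow> g = Stieltjes \<rho> z)"
proof -
  interpret free_convolution_laws \<mu> \<nu> \<rho>
    using assms by (simp add: free_convolution_laws_def free_convolution_laws_axioms_def
        compact_law_iff is_free_convolution_def)
  let ?I = "{g. 0 < g \<and> ereal g < Stieltjes_minus \<rho>}"
  \<comment> \<open>For \<open>g\<close> in \<open>?I\<close>, \<open>less_both\<close> puts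
    \<open>- g\<close> into \<open>Dhat \<mu>\<close> automatically, so both index sets reduce to
    the support constraint.\<close>
  define S where "S = {g \<in> ?I. z - R_transform \<mu> (- g) < n.lo}"
  have hat: "Ehat_set \<mu> \<nu> z \<inter> ?I = S"
    using less_both(1) m.minus_in_Dhat_iff by (auto simp: S_def Ehat_set_def)
  have full: "E_set \<mu> \<nu> z \<inter> ?I = S"
    using less_both(1) m.minus_in_Dhat_iff m.Dhat_subset_R_domain by (auto simp: S_def E_set_def)
  have mem: "r.G z \<in> S"
    using assms(5) E_fun_at_minimizer(1) r.G_pos r.G_less_Stieltjes_minus by (simp add: S_def)
  have val: "E_fun \<mu> \<nu> z (r.G z) = r.U z"
    using assms(5) by (rule E_fun_at_minimizer)
  have "E_fun \<mu> \<nu> z (r.G z) < E_fun \<mu> \<nu> z g" if "g \<in> S" "g \<noteq> r.G z" for g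
    unfolding val using that by (intro E_fun_greater assms) (auto simp: S_def)
  from arg_min_INF_unique[of "r.G z" S "E_fun \<mu> \<nu> z", OF mem this] show ?thesis
    unfolding hat full by (simp add: val)
qed

end
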